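(* Let $m\ge3$ and let $\mathcal{P}_2^m$ be the space of convex polygons in $\mathbb{R}^2$ with $m$ vertices containing the origin in their interior. If the functional $c_1:\mathcal{P}_2^m\to\mathbb{R}$ is stationary at $P$, then $P$ is a linear image (under an element of $\mathrm{GL}_2(\mathbb{R})$) of the regular polygon $D^m$ with $m$ vertices centered at the origin. Moreover, among all $P\in\mathcal{P}_2^m$ with $s_\infty(P)$ at the origin, $c_1(P)$ is uniquely maximized by the linear images of $D^m$.
   Context: The space $\mathcal{P}_2^m$ is a smooth manifold of dimension $2m$, parametrized locally by the (ordered) vertices of the polygon; $c_1$ is stationary at $P$ if its differential vanishes there. For $P\in\mathcal{P}_2^m$, let $v_1,\dots,v_m$ be its consecutive vertices (indices mod $m$) and $e_1,\dots,e_m$ the consecutive vertices of the polar polygon $P^\circ=\{\xi:\langle\xi,y\rangle\le1\ \forall y\in P\}$, labelled so that $\langle e_i,v_i\rangle=\langle e_i,v_{i-1}\rangle=1$. Then $$c_1(P):=\frac12\sum_{j=1}^m\Big[\log\big(1-\langle e_{j-1},v_j\rangle\big)+\log\big(1-\langle e_{j+2},v_j\rangle\big)\Big],$$ i.e. half the sum of $\log(1-\langle e_i,v_j\rangle)$ over pairs such that the vertex $v_j$ is not on the edge $e_i$ but a neighbouring vertex of $v_j$ is. (This is the coefficient of $R$ in the expansion as $R\to\infty$ of the Funk volume of the forward ball of radius $R$ about the origin, times $\omega_2=\pi$.) For a convex polygon $P$ and $x\in\operatorname{int}P$, set $c_1(P,x):=c_1(P-x)$. The function $x\mapsto c_1(P,x)$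 on $\operatorname{int}P$ has a unique minimum point, denoted $s_\infty(P)$. *)

theory Defs
  imports "HOL-Analysis.Analysis"
begin

text \<open>The space of convex polygons with exactly \<open>m\<close> vertices and the origin in the interior. The
  interior condition forces the polytope to be two-dimensional.\<close>

definition polygons :: "nat \<Rightarrow> (real^2) set set" where
  "polygons m = {P. polytope P \<and> card {x. x extreme_point_of P} = m \<and> 0 \<in> interior P}"

definition polar :: "(real^2) set \<Rightarrow> (real^2) set" where
  "polar P = {\<xi>. \<forall>y\<in>P. \<xi> \<bullet> y \<le> 1}"

text \<open>\<open>v\<close> runs once through the vertices of \<open>P\<close>, in one of the two cyclic orders. Indices modulo \<open>m\<close>
  are rendered as integers together with \<open>m\<close>-periodicity of \<open>v\<close>.\<close>

definition consecutive_vertices :: "nat \<Rightarrow> (real^2) set \<Rightarrow> (int \<Rightarrow> real^2) \<Rightarrow> bool" where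
  "consecutive_vertices m P v \<longleftrightarrow>
     (\<forall>i. v (i + int m) = v i) \<and>
     bij_betw v {0..<int m} {x. x extreme_point_of P} \<and>
     (\<forall>i. closed_segment (v i) (v (i + 1)) edge_of P)"

definition vertex_labelling ::
    "nat \<Rightarrow> (real^2) set \<Rightarrow> (int \<Rightarrow> real^2) \<times> (int \<Rightarrow> real^2) \<Rightarrow> bool" where
  "vertex_labelling m P = (\<lambda>(v, e).
     consecutive_vertices m P v \<and> consecutive_vertices m (polar P) e \<and>
     (\<forall>i. e i \<bullet> v i = 1 \<and> e i \<bullet> v (i - 1) = 1))"

text \<open>The value does not depend on the labelling: two labellings of a polygon differ by a rotation
  or reflection of the indices, which permutes the summands. For \<open>m = 3\<close> the indices \<open>j - 1\<close> and
  \<open>j + 2\<close> agree, and the corresponding logarithm is counted twice.\<close>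

definition c1 :: "(real^2) set \<Rightarrow> real" where
  "c1 P =
     (let m = card {x. x extreme_point_of P};
          (v, e) = (SOME ve. vertex_labelling m P ve)
      in (1/2) * (\<Sum>j\<in>{1..int m}. ln (1 - e (j - 1) \<bullet> v j) + ln (1 - e (j + 2) \<bullet> v j)))"

definition c1_at :: "(real^2) set \<Rightarrow> real^2 \<Rightarrow> real" where
  "c1_at P x = c1 ((\<lambda>y. y - x) ` P)"

definition s_inf :: "(real^2) set \<Rightarrow> real^2" where
  "s_inf P = (THE x. is_arg_min (c1_at P) (\<lambda>x. x \<in> interior P) x)"

text \<open>The differential of \<open>c1\<close> at an \<open>m\<close>-gon \<open>P\<close>, \<open>m = CARD('n)\<close>, is taken in the chart that
  sends a tuple \<open>W\<close> of points near the tuple \<open>V\<close> of vertices of \<open>P\<close> to the polygon with vertices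
  \<open>W\<close>. The order in which \<open>V\<close> lists the vertices is immaterial: two such charts differ by a
  permutation of the coordinates.\<close>

definition c1_stationary :: "'n::finite itself \<Rightarrow> (real^2) set \<Rightarrow> bool" where
  "c1_stationary _ P \<longleftrightarrow>
     (\<exists>V :: (real^2)^'n.
        bij_betw (\<lambda>i. V $ i) UNIV {x. x extreme_point_of P} \<and>
        ((\<lambda>W :: (real^2)^'n. c1 (convex hull (range (\<lambda>i. W $ i)))) has_derivative (\<lambda>_. 0)) (at V))"

definition regular_polygon :: "nat \<Rightarrow> (real^2) set" where
  "regular_polygon m =
     convex hull {vector [cos (2 * pi * real k / real m), sin (2 * pi * real k / real m)] |k. k < m}"

definition linear_image_of :: "(real^2) set \<Rightarrow> (real^2) set \<Rightarrow> bool" where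
  "linear_image_of P D \<longleftrightarrow> (\<exists>A :: real^2^2. invertible A \<and> P = (\<lambda>x. A *v x) ` D)"

end

theory Submission
  imports Defs
begin

text \<open>
  Write \<open>[a, b]\<close> for the determinant of two plane vectors, let \<open>v\<close> run counterclockwise through the
  vertices of a polygon, and put \<open>d j = [v (j-1), v j]\<close> and \<open>T j = [v j - v (j-1), v (j+1) - v j]\<close>. Each
  slack \<open>1 - e i \<bullet> x\<close> is the ratio of the determinant of the triangle \<open>v (i-1), v i, x\<close> to \<open>d i\<close>.
  Hence \<open>c1 P = (\<Sum>j. ln (T j) - ln (d j))\<close>, a function of the vertices
  alone; it takes the same value on the polar polygon, because slacks are symmetric in vertices
  and dual vertices.

  \<^bold>\<open>Stationary polygons.\<close> The derivative of this sum in \<open>v j\<close> is one covector. Pairing it with the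
  two edges at \<open>v j\<close>, and writing \<open>f j = [v (j-1), v (j+1)]\<close> and \<open>g j = [v (j-1) - v (j-2), v (j+1) - v j]\<close>,
  turns stationarity into \<open>g j * d j = f j * T (j-1) = f (j-1) * T j\<close>. Together with the
  Pluecker relation between \<open>d\<close>, \<open>f\<close> and \<open>g\<close> this forces \<open>d (j-1) * d (j+1) = (d j)\<^sup>2\<close>. A periodic geometric
  progression is constant, so \<open>d\<close> and \<open>f\<close> are constant and \<open>v (j+1) + v (j-1)\<close> is a fixed multiple of
  \<open>v j\<close>: the vertices are the orbit of a linear map conjugate to a rotation, and convexity
  makes its angle \<open>2\<pi>/m\<close> (\<open>regular_if_covector_zero\<close>, \<open>regular_if_constant\<close>).

  \<^bold>\<open>Maximizers.\<close> Translating \<open>P\<close> by \<open>- x\<close> subtracts \<open>\<Sum>j. ln (1 - e j \<bullet> x)\<close> from \<open>c1\<close>. This function of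
  \<open>x\<close> is strictly concave, so \<open>s_inf P = 0\<close> says that the dual vertices \<open>e j\<close> have sum zero
  (\<open>s_inf_eq_0_iff\<close>). By polarity the task is to maximize the functional over polygons \<open>u\<close> under
  the linear constraint \<open>\<Sum>j. u j = 0\<close>. After a linear map the vertices satisfy
  \<open>\<Sum>j. (n \<bullet> u j)\<^sup>2 = n \<bullet> n\<close> for all \<open>n\<close>; then every \<open>d j\<close> and \<open>T j\<close> is bounded below in terms of the value of the
  functional, and so is every triangle spanned by an edge and another vertex. The polygons that are at
  least as good as the regular one thus form a compact set, and a maximum exists
  (\<open>maximum_exists\<close>). At a maximum the derivative is a Lagrange multiplier. It vanishes, because the
  functional is also stationary along the projective motions that translate the polar polygon, and
  these leave the constraint set (\<open>covector_zero_if_constrained_critical\<close>). So a maximum is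
  stationary without constraint, hence regular.
\<close>

section \<open>Determinants in the plane\<close>

definition det2 :: "real^2 \<Rightarrow> real^2 \<Rightarrow> real" where
  "det2 a b = a $ 1 * b $ 2 - a $ 2 * b $ 1"

definition triangle_det :: "real^2 \<Rightarrow> real^2 \<Rightarrow> real^2 \<Rightarrow> real" where
  "triangle_det a b c = det2 a b + det2 b c + det2 c a"

definition quarter_turn :: "real^2 \<Rightarrow> real^2" where
  "quarter_turn a = vector [- a $ 2, a $ 1]"

lemma inner_real2: "(a :: real^2) \<bullet> b = a $ 1 * b $ 1 + a $ 2 * b $ 2"
  by (simp add: inner_vec_def sum_2)

lemma real2_eq_iff: "(a :: real^2) = b \<longleftrightarrow> a $ 1 = b $ 1 \<and> a $ 2 = b $ 2"
  by (simp add: vec_eq_iff forall_2)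

lemma quarter_turn_nth [simp]: "quarter_turn a $ 1 = - a $ 2" "quarter_turn a $ 2 = a $ 1"
  by (simp_all add: quarter_turn_def)

lemma quarter_turn_inner: "quarter_turn a \<bullet> b = det2 a b"
  by (simp add: inner_real2 det2_def)

lemma det2_quarter_turn: "det2 a (quarter_turn b) = a \<bullet> b"
  by (simp add: inner_real2 det2_def)

lemma det2_self [simp]: "det2 a a = 0"
  by (simp add: det2_def)

lemma det2_zero [simp]: "det2 0 a = 0" "det2 a 0 = 0"
  by (simp_all add: det2_def)

lemma det2_swap: "det2 b a = - det2 a b"
  by (simp add: det2_def)

lemma det2_linear:
  "det2 (a + b) c = det2 a c + det2 b c" "det2 (a - b) c = det2 a c - det2 b c"
  "det2 (r *\<^sub>R a) c = r * det2 a c" "det2 (- a) c = - det2 a c"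
  "det2 c (a + b) = det2 c a + det2 c b" "det2 c (a - b) = det2 c a - det2 c b"
  "det2 c (r *\<^sub>R a) = r * det2 c a" "det2 c (- a) = - det2 c a"
  by (simp_all add: det2_def algebra_simps)

lemma det2_expand: "det2 p q *\<^sub>R x = det2 x q *\<^sub>R p + det2 p x *\<^sub>R q"
  by (simp add: real2_eq_iff det2_def algebra_simps)

lemma triangle_det_rotate: "triangle_det b c a = triangle_det a b c"
  by (simp add: triangle_det_def)

lemma det2_matrix: "det2 (A *v a) (A *v b) = det A * det2 a b"
  by (simp add: det2_def matrix_vector_mult_def sum_2 det_2 algebra_simps)

lemma det2_eq_zero_imp:
  assumes "det2 p x = 0" "det2 q x = 0" "det2 p q \<noteq> 0"
  shows "x = 0"
proof -
  have "det2 p q *\<^sub>R x = 0"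
    using det2_expand[of p q x] assms det2_swap[of q x] by simp
  then show ?thesis using assms(3) by simp
qed

lemma inner_eq_zero_imp:
  assumes "x \<bullet> p = 0" "x \<bullet> q = 0" "det2 p q \<noteq> 0"
  shows "x = 0"
  using det2_eq_zero_imp[of p "quarter_turn x" q] assms
  by (simp add: det2_quarter_turn inner_commute real2_eq_iff)

section \<open>Convex cycles and their duals\<close>

text \<open>The vertices of a convex polygon around the origin in counterclockwise order, described by
  finitely many strict inequalities up to periodicity, so that the condition is open. Positive
  \<open>det2\<close> of neighbours makes the polygon wind around the origin; the triangle condition excludes
  multiple winding.\<close>

locale convex_cycle =
  fixes m :: nat and v :: "int \<Rightarrow> real^2"
  assumes three_le: "3 \<le> m"
    and periodic [simp]: "v (i + int m) = v i"
    and det_pos: "0 < det2 (v (i - 1)) (v i)"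
    and left_of_edge: "i < k \<Longrightarrow> k < i + int m - 1 \<Longrightarrow> 0 < triangle_det (v (i - 1)) (v i) (v k)"

text \<open>The solution \<open>\<xi>\<close> of \<open>\<xi> \<bullet> v (i - 1) = \<xi> \<bullet> v i = 1\<close>: the vertex of the polar polygon that belongs to the
  edge from \<open>v (i - 1)\<close> to \<open>v i\<close>.\<close>

definition dual_vertex :: "(int \<Rightarrow> real^2) \<Rightarrow> int \<Rightarrow> real^2" where
  "dual_vertex v i = quarter_turn (v (i - 1) - v i) /\<^sub>R det2 (v (i - 1)) (v i)"

lemma dual_vertex_inner:
  assumes "det2 (v (i - 1)) (v i) \<noteq> 0"
  shows "det2 (v (i - 1)) (v i) * (dual_vertex v i \<bullet> x) = det2 (v (i - 1) - v i) x"
  using assms by (simp add: dual_vertex_def quarter_turn_inner)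

lemma periodic_mult:
  assumes "\<And>i. f (i + int m) = f i"
  shows "f (i + k * int m) = f i"
proof (induction k rule: int_induct[where k=0])
  case (step1 k)
  have "f (i + (k + 1) * int m) = f ((i + k * int m) + int m)" by (simp add: algebra_simps)
  then show ?case using step1 assms by simp
next
  case (step2 k)
  have "f (i + k * int m) = f ((i + (k - 1) * int m) + int m)" by (simp add: algebra_simps)
  then show ?case using step2 assms by simp
qed simp

lemma window_representative:
  assumes "0 < m"
  obtains k' q where "k' = k + q * int m" "a \<le> k'" "k' < a + int m"
proof
  show "a + (k - a) mod int m = k + (- ((k - a) div int m)) * int m"
    using div_mult_mod_eq[of "k - a" "int m"] by (simp add: algebra_simps)
  show "a \<le> a + (k - a) mod int m" "a + (k - a) mod int m < a + int m"
    using assms by simp_all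
qed

lemma periodic_window:
  assumes "\<And>i. f (i + int m) = f i" "0 < m"
  obtains k' where "f k' = f k" "a \<le> k'" "k' < a + int m"
  using window_representative[OF assms(2), of k a] periodic_mult[of f m k, OF assms(1)] by metis

lemma periodic_range:
  assumes "\<And>i. f (i + int m) = f i" "0 < m"
  shows "range f = f ` {0..<int m}"
proof -
  have "f k \<in> f ` {0..<int m}" for k
    by (rule periodic_window[where f=f and m=m and k=k and a=0])
      (use assms in \<open>auto intro: image_eqI[OF sym]\<close>)
  then show ?thesis by auto
qed

lemma periodic_sum_shift_one:
  fixes f :: "int \<Rightarrow> 'a::ab_group_add"
  assumes "\<And>i. f (i + int m) = f i"
  shows "(\<Sum>j\<in>{0..<int m}. f (j + 1)) = (\<Sum>j\<in>{0..<int m}. f j)"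
proof (cases "m = 0")
  case False
  have "(\<Sum>j\<in>{0..<int m}. f (j + 1)) = (\<Sum>j\<in>{1..<int m + 1}. f j)"
    by (rule sum.reindex_bij_witness[where i="\<lambda>j. j - 1" and j="\<lambda>j. j + 1"]) auto
  also have "\<dots> = (\<Sum>j\<in>insert (int m) {1..<int m}. f j)"
    using False by (intro sum.cong) auto
  also have "\<dots> = (\<Sum>j\<in>insert 0 {1..<int m}. f j)"
    using assms[of 0] by (simp add: add.commute)
  also have "\<dots> = (\<Sum>j\<in>{0..<int m}. f j)"
    using False by (intro sum.cong) auto
  finally show ?thesis .
qed simp

lemma periodic_sum_shift:
  fixes f :: "int \<Rightarrow> 'a::ab_group_add"
  assumes "\<And>i. f (i + int m) = f i"
  shows "(\<Sum>j\<in>{0..<int m}. f (j + a)) = (\<Sum>j\<in>{0..<int m}. f j)"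
proof (induction a rule: int_induct[where k=0])
  case (step1 a)
  have "(\<Sum>j\<in>{0..<int m}. f (j + (a + 1))) = (\<Sum>j\<in>{0..<int m}. (\<lambda>j. f (j + a)) (j + 1))"
    by (simp add: algebra_simps)
  also have "\<dots> = (\<Sum>j\<in>{0..<int m}. f (j + a))"
  proof (rule periodic_sum_shift_one)
    show "f (i + int m + a) = f (i + a)" for i
      using assms[of "i + a"] by (simp add: add.assoc add.commute add.left_commute)
  qed
  finally show ?case using step1 by simp
next
  case (step2 a)
  have "(\<Sum>j\<in>{0..<int m}. f (j + a)) = (\<Sum>j\<in>{0..<int m}. (\<lambda>j. f (j + (a - 1))) (j + 1))"
    by (simp add: algebra_simps)
  also have "\<dots> = (\<Sum>j\<in>{0..<int m}. f (j + (a - 1)))"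
  proof (rule periodic_sum_shift_one)
    show "f (i + int m + (a - 1)) = f (i + (a - 1))" for i
      using assms[of "i + (a - 1)"] by (simp add: add.assoc add.commute add.left_commute)
  qed
  finally show ?case using step2 by simp
qed simp

context convex_cycle
begin

lemma m_pos: "0 < m" using three_le by simp

abbreviation "e \<equiv> dual_vertex v"

lemma range_eq: "range v = v ` {0..<int m}"
  by (rule periodic_range) (use m_pos in auto)

lemma periodic_minus [simp]: "v (i + int m - c) = v (i - c)"
  using periodic[of "i - c"] by (simp add: algebra_simps)

lemma dual_periodic: "e (i + int m) = e i"
  by (simp add: dual_vertex_def)

text \<open>Both sides are affine in \<open>x\<close>, vanish at \<open>v (i - 1)\<close> and \<open>v i\<close>, and agree at the origin. This
  identity translates between dual vertices and determinants.\<close>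

lemma slack_eq:
  "det2 (v (i - 1)) (v i) * (1 - e i \<bullet> x) = triangle_det (v (i - 1)) (v i) x"
proof -
  have "det2 (v (i - 1)) (v i) * (e i \<bullet> x) = det2 (v (i - 1) - v i) x"
    using det_pos[of i] by (simp add: dual_vertex_def quarter_turn_inner)
  then show ?thesis
    using det2_swap[of "v (i - 1)" x] by (simp add: right_diff_distrib triangle_det_def det2_linear)
qed

lemma slack_eq_divide:
  "1 - e i \<bullet> x = triangle_det (v (i - 1)) (v i) x / det2 (v (i - 1)) (v i)"
  using slack_eq[of i x] det_pos[of i] by (simp add: field_simps)

lemma dual_inner [simp]: "e i \<bullet> v i = 1" "e i \<bullet> v (i - 1) = 1"
  using slack_eq_divide[of i "v i"] slack_eq_divide[of i "v (i - 1)"] det2_swap[of "v i" "v (i - 1)"]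
  by (simp_all add: triangle_det_def)

lemma dual_inner_next [simp]: "e (i + 1) \<bullet> v i = 1"
  using dual_inner(2)[of "i + 1"] by simp

lemma dual_eqI:
  assumes "x \<bullet> v i = 1" "x \<bullet> v (i - 1) = 1"
  shows "x = e i"
proof -
  have "x - e i = 0"
    by (rule inner_eq_zero_imp[of _ "v (i - 1)" "v i"])
      (use assms det_pos[of i] in \<open>simp_all add: inner_diff_left\<close>)
  then show ?thesis by simp
qed

lemma dual_inner_less:
  assumes "i < k" "k < i + int m - 1"
  shows "e i \<bullet> v k < 1"
proof -
  have "0 < 1 - e i \<bullet> v k"
    unfolding slack_eq_divide using left_of_edge[OF assms] det_pos[of i] by simp
  then show ?thesis by simp
qed

lemma dual_inner_le: "e i \<bullet> v k \<le> 1"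
proof -
  obtain k' where k': "v k' = v k" "i \<le> k'" "k' < i + int m"
    by (rule periodic_window[of v m k i]) (use m_pos in auto)
  consider "k' = i" | "k' = i + int m - 1" | "i < k'" "k' < i + int m - 1" using k' by linarith
  then show ?thesis
    by cases (use k' dual_inner_less[of i k'] dual_inner[of i] periodic_minus[of i 1] in \<open>auto simp del: periodic_minus\<close>)
qed

lemma dual_inner_eq_1_cases:
  assumes "e i \<bullet> v k = 1"
  shows "v k = v i \<or> v k = v (i - 1)"
proof -
  obtain k' where k': "v k' = v k" "i \<le> k'" "k' < i + int m"
    by (rule periodic_window[of v m k i]) (use m_pos in auto)
  consider "k' = i" | "k' = i + int m - 1" | "i < k'" "k' < i + int m - 1" using k' by linarith
  then show ?thesis
    by cases (use k' assms dual_inner_less[of i k'] periodic_minus[of i 1] in \<open>auto simp del: periodic_minus\<close>)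
qed

lemma corner_pos: "0 < triangle_det (v (i - 1)) (v i) (v (i + 1))"
  by (rule left_of_edge) (use three_le in auto)

lemma dual_det: "det2 (e i) (e (i + 1)) * det2 (v (i - 1)) (v i) * det2 (v i) (v (i + 1))
    = triangle_det (v (i - 1)) (v i) (v (i + 1))"
proof -
  have "det2 (quarter_turn a) (quarter_turn b) = det2 a b" for a b by (simp add: det2_def)
  then have "det2 (e i) (e (i + 1)) = det2 (v (i - 1) - v i) (v i - v (i + 1)) /
      (det2 (v (i - 1)) (v i) * det2 (v i) (v (i + 1)))"
    by (simp add: dual_vertex_def det2_linear field_simps)
  moreover have "det2 (v (i - 1) - v i) (v i - v (i + 1)) = triangle_det (v (i - 1)) (v i) (v (i + 1))"
    by (simp add: triangle_det_def det2_def algebra_simps)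
  ultimately show ?thesis using det_pos[of i] det_pos[of "i + 1"] by simp
qed

lemma dual_det_pos: "0 < det2 (e i) (e (i + 1))"
proof -
  have "0 < det2 (e i) (e (i + 1)) * (det2 (v (i - 1)) (v i) * det2 (v i) (v (i + 1)))"
    using dual_det[of i] corner_pos[of i] by (simp add: mult.assoc)
  then show ?thesis
    using zero_less_mult_pos2 mult_pos_pos[OF det_pos[of i] det_pos[of "i + 1"]] by fastforce
qed

text \<open>The index drops by one because the edge from \<open>e (i - 1)\<close> to \<open>e i\<close> belongs to the vertex that the
  edges \<open>i - 1\<close> and \<open>i\<close> share.\<close>

lemma dual_dual: "dual_vertex e i = v (i - 1)"
proof -
  have d: "0 < det2 (e (i - 1)) (e i)" using dual_det_pos[of "i - 1"] by simp
  note slack = dual_vertex_inner[of e i, OF less_imp_neq[OF d, symmetric]]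
  have "dual_vertex e i \<bullet> e i = 1" "dual_vertex e i \<bullet> e (i - 1) = 1"
    using slack[of "e i"] slack[of "e (i - 1)"] d det2_swap[of "e i" "e (i - 1)"]
    by (simp_all add: det2_linear)
  then have "dual_vertex e i - v (i - 1) = 0"
    by (intro inner_eq_zero_imp[of _ "e (i - 1)" "e i"])
      (use d in \<open>simp_all add: inner_diff_left inner_commute[of "v (i - 1)"]\<close>)
  then show ?thesis by simp
qed

text \<open>For both cycles the triangle condition says \<open>e k \<bullet> v i < 1\<close> for all pairs that are not incident,
  a condition symmetric in the two.\<close>

lemma dual_convex_cycle: "convex_cycle m e"
proof
  show "0 < det2 (e (i - 1)) (e i)" for i using dual_det_pos[of "i - 1"] by simp
  show "0 < triangle_det (e (i - 1)) (e i) (e k)" if "i < k" "k < i + int m - 1" for i k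
  proof -
    have d: "0 < det2 (e (i - 1)) (e i)" using dual_det_pos[of "i - 1"] by simp
    have "det2 (e (i - 1)) (e i) * (dual_vertex e i \<bullet> e k) = det2 (e (i - 1) - e i) (e k)"
      using d by (intro dual_vertex_inner) simp
    then have "triangle_det (e (i - 1)) (e i) (e k) = det2 (e (i - 1)) (e i) * (1 - v (i - 1) \<bullet> e k)"
      using det2_swap[of "e k" "e (i - 1)"]
      by (simp add: right_diff_distrib triangle_det_def det2_linear dual_dual)
    moreover have "e k \<bullet> v (i - 1) < 1"
      using dual_inner_less[of k "i - 1 + int m"] that by (simp add: algebra_simps)
    ultimately show ?thesis using d by (simp add: inner_commute)
  qed
qed (use three_le dual_periodic in auto)

end

section \<open>The polygon spanned by a convex cycle\<close>

context convex_cycle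
begin

text \<open>In an open half-plane, \<open>det2 n (v i) / (n \<bullet> v i)\<close> would increase strictly with \<open>i\<close>, against periodicity;
  a vertex on the bounding line is excluded by its two neighbours.\<close>

lemma not_in_halfplane:
  assumes "n \<noteq> 0"
  shows "\<exists>k. n \<bullet> v k < 0"
proof (rule ccontr)
  assume "\<not> ?thesis"
  then have nonneg: "0 \<le> n \<bullet> v k" for k by (simp add: not_less)
  have step: "0 < (n \<bullet> v (i - 1)) * det2 n (v i) - (n \<bullet> v i) * det2 n (v (i - 1))" for i
  proof -
    have "(n \<bullet> v (i - 1)) * det2 n (v i) - (n \<bullet> v i) * det2 n (v (i - 1)) = (n \<bullet> n) * det2 (v (i - 1)) (v i)"
      by (simp add: inner_real2 det2_def algebra_simps)
    then show ?thesis using assms det_pos[of i] by simp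
  qed
  have pos: "0 < n \<bullet> v i" for i
  proof (rule ccontr)
    assume "\<not> 0 < n \<bullet> v i"
    then have z: "n \<bullet> v i = 0" using nonneg[of i] by simp
    have "0 < det2 n (v i)"
      using step[of i] nonneg[of "i - 1"] z by (simp add: zero_less_mult_iff)
    then show False
      using step[of "i + 1"] nonneg[of "i + 1"] z by (simp add: mult_less_0_iff)
  qed
  define q where "q i = det2 n (v i) / (n \<bullet> v i)" for i
  have q_less: "q (i - 1) < q i" for i
    using step[of i] pos[of i] pos[of "i - 1"] by (simp add: q_def field_simps)
  have "q 0 + (if k = 0 then 0 else q 1 - q 0) \<le> q (int k)" for k
  proof (induction k)
    case (Suc k)
    then show ?case using q_less[of "int k + 1"] q_less[of 1]
      by (auto simp: add.commute split: if_splits)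
  qed simp
  from this[of m] have "q 1 \<le> q (int m)" using m_pos by simp
  moreover have "q (int m) = q 0" using periodic[of 0] by (simp add: q_def)
  ultimately show False using q_less[of 1] by simp
qed

lemma sign_change:
  fixes s :: "int \<Rightarrow> real"
  assumes "\<And>i. s (i + int m) = s i" "s a < 0" "0 \<le> s b"
  shows "\<exists>i. 0 \<le> s (i - 1) \<and> s i < 0"
proof (rule ccontr)
  assume none: "\<not> ?thesis"
  obtain a' where a': "s a' = s a" "b \<le> a'"
    by (rule periodic_window[of s m a b]) (use assms m_pos in auto)
  have "0 \<le> s (b + int k)" for k
  proof (induction k)
    case (Suc k)
    then show ?case using none by (auto simp: not_less add.commute dest: spec[of _ "b + int k + 1"])
  qed (use assms in simp)
  from this[of "nat (a' - b)"] show False using a' assms by simp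
qed

text \<open>By \<open>not_in_halfplane\<close> the function \<open>i \<mapsto> det2 (v i) x\<close> takes both signs, so it changes sign from
  nonnegative to negative between two consecutive vertices, and \<open>x\<close> lies in their cone.\<close>

lemma cone_cover: "\<exists>i \<alpha> \<beta>. 0 \<le> \<alpha> \<and> 0 \<le> \<beta> \<and> x = \<alpha> *\<^sub>R v (i - 1) + \<beta> *\<^sub>R v i"
proof (cases "x = 0")
  case True
  then show ?thesis by (intro exI[of _ 0]) simp
next
  case False
  define s where "s i = det2 (v i) x" for i
  have turn: "quarter_turn x \<bullet> v k = - s k" "- quarter_turn x \<bullet> v k = s k" for k
    using det2_swap[of x] by (simp_all add: s_def quarter_turn_inner)
  have nz: "quarter_turn x \<noteq> 0" "- quarter_turn x \<noteq> 0" using False by (auto simp: real2_eq_iff)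
  obtain a where "s a < 0" using not_in_halfplane[OF nz(2)] turn by auto
  moreover obtain b where "0 < s b" using not_in_halfplane[OF nz(1)] turn by auto
  moreover have "s (i + int m) = s i" for i by (simp add: s_def)
  ultimately obtain i where i: "0 \<le> s (i - 1)" "s i < 0"
    using sign_change[of s a b] by auto
  let ?d = "det2 (v (i - 1)) (v i)"
  have d: "0 < ?d" by (rule det_pos)
  have "x = (1 / ?d) *\<^sub>R (?d *\<^sub>R x)" using d by simp
  also have "\<dots> = (- s i / ?d) *\<^sub>R v (i - 1) + (s (i - 1) / ?d) *\<^sub>R v i"
    unfolding det2_expand[of "v (i - 1)" "v i" x] s_def
    using det2_swap[of "v i" x] by (simp add: scaleR_right_distrib)
  finally have "x = (- s i / ?d) *\<^sub>R v (i - 1) + (s (i - 1) / ?d) *\<^sub>R v i" .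
  moreover have "0 \<le> - s i / ?d" "0 \<le> s (i - 1) / ?d"
    using i d by (auto intro!: divide_nonneg_pos divide_nonpos_pos)
  ultimately show ?thesis by blast
qed

abbreviation "polygon \<equiv> convex hull (range v)"

lemma vertex_mem: "v i \<in> polygon"
  by (simp add: hull_inc)

lemma triangle_subset:
  assumes "z \<in> polygon" "0 \<le> \<alpha>" "0 \<le> \<beta>" "0 \<le> \<gamma>" "\<alpha> + \<beta> + \<gamma> = 1"
  shows "\<alpha> *\<^sub>R v i + \<beta> *\<^sub>R v j + \<gamma> *\<^sub>R z \<in> polygon"
proof -
  have "convex hull {v i, v j, z} \<subseteq> polygon"
    by (rule hull_minimal) (use assms vertex_mem in auto)
  moreover have "\<alpha> *\<^sub>R v i + \<beta> *\<^sub>R v j + \<gamma> *\<^sub>R z \<in> convex hull {v i, v j, z}"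
    unfolding convex_hull_3 using assms(2-) by blast
  ultimately show ?thesis by blast
qed

lemma zero_mem: "0 \<in> polygon"
proof -
  obtain i \<alpha> \<beta> where *: "0 \<le> \<alpha>" "0 \<le> \<beta>" "- v 0 = \<alpha> *\<^sub>R v (i - 1) + \<beta> *\<^sub>R v i"
    using cone_cover by blast
  define c where "c = 1 + \<alpha> + \<beta>"
  have c: "0 < c" using *(1,2) by (simp add: c_def)
  have "(\<alpha> / c) *\<^sub>R v (i - 1) + (\<beta> / c) *\<^sub>R v i + (1 / c) *\<^sub>R v 0
    = (1 / c) *\<^sub>R (\<alpha> *\<^sub>R v (i - 1) + \<beta> *\<^sub>R v i + v 0)"
    by (simp add: scaleR_right_distrib)
  also have "\<dots> = 0" unfolding *(3)[symmetric] by simp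
  finally have "(\<alpha> / c) *\<^sub>R v (i - 1) + (\<beta> / c) *\<^sub>R v i + (1 / c) *\<^sub>R v 0 = 0" .
  moreover have "\<alpha> / c + \<beta> / c + 1 / c = 1"
    using c by (simp add: c_def add_divide_distrib[symmetric])
  ultimately show ?thesis
    using triangle_subset[OF vertex_mem[of 0], of "\<alpha> / c" "\<beta> / c" "1 / c" "i - 1" i] c *(1,2) by simp
qed

text \<open>A point with all slacks nonnegative lies in the cone over some edge, on the same side of that edge
  as the origin, hence in the triangle of the origin and the edge.\<close>

lemma polygon_eq: "polygon = {x. \<forall>i. e i \<bullet> x \<le> 1}"
proof
  have "convex {x. \<forall>i. e i \<bullet> x \<le> 1}"
    unfolding Collect_all_eq by (intro convex_INT convex_halfspace_le)
  then show "polygon \<subseteq> {x. \<forall>i. e i \<bullet> x \<le> 1}"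
    by (intro hull_minimal) (use dual_inner_le in auto)
  show "{x. \<forall>i. e i \<bullet> x \<le> 1} \<subseteq> polygon"
  proof clarify
    fix x assume x: "\<forall>i. e i \<bullet> x \<le> 1"
    obtain i \<alpha> \<beta> where *: "0 \<le> \<alpha>" "0 \<le> \<beta>" "x = \<alpha> *\<^sub>R v (i - 1) + \<beta> *\<^sub>R v i"
      using cone_cover by blast
    have "\<alpha> + \<beta> \<le> 1" using x[rule_format, of i] by (simp add: *(3) inner_add_right)
    then show "x \<in> polygon"
      using triangle_subset[OF zero_mem *(1,2), of "1 - \<alpha> - \<beta>" "i - 1" i] *(3) by simp
  qed
qed

lemma finite_range: "finite (range v)"
  unfolding range_eq by simp

lemma finite_range_dual: "finite (range e)"
  using convex_cycle.finite_range[OF dual_convex_cycle] .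

lemma interior_polygon: "interior polygon = {x. \<forall>i. e i \<bullet> x < 1}"
proof
  have "open (\<Inter>w\<in>range e. {x. w \<bullet> x < 1})"
    using finite_range_dual by (intro open_INT ballI open_halfspace_lt)
  moreover have "(\<Inter>w\<in>range e. {x. w \<bullet> x < 1}) = {x. \<forall>i. e i \<bullet> x < 1}" by auto
  ultimately have "open {x. \<forall>i. e i \<bullet> x < 1}" by simp
  moreover have "{x. \<forall>i. e i \<bullet> x < 1} \<subseteq> polygon" unfolding polygon_eq by (auto intro: less_imp_le)
  ultimately show "{x. \<forall>i. e i \<bullet> x < 1} \<subseteq> interior polygon" by (simp add: interior_maximal)
  show "interior polygon \<subseteq> {x. \<forall>i. e i \<bullet> x < 1}"
  proof clarify
    fix x i assume "x \<in> interior polygon"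
    moreover have "interior polygon \<subseteq> interior {x. e i \<bullet> x \<le> 1}"
      by (rule interior_mono) (auto simp: polygon_eq)
    moreover have "e i \<noteq> 0" by (metis dual_inner(1) inner_zero_left zero_neq_one)
    ultimately show "e i \<bullet> x < 1" by auto
  qed
qed

lemma distinct_vertices:
  assumes "i < k" "k < i + int m"
  shows "v k \<noteq> v i"
proof (cases "k = i + int m - 1")
  case True
  then have "k = i - 1 + int m" by simp
  then have "v k = v (i - 1)" by (simp only: periodic)
  then show ?thesis using det_pos[of i] by auto
next
  case False
  then have "e i \<bullet> v k < 1" using assms by (intro dual_inner_less) auto
  then show ?thesis by auto
qed

lemma inj_on_window: "inj_on v {a..<a + int m}"
proof (rule inj_onI, rule ccontr)
  fix x y assume *: "x \<in> {a..<a + int m}" "y \<in> {a..<a + int m}" "v x = v y" "x \<noteq> y"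
  then show False using distinct_vertices[of x y] distinct_vertices[of y x] by (cases "x < y") auto
qed

lemma neighbours_distinct: "v (i + 1) \<noteq> v i" "v (i - 1) \<noteq> v i" "v (i + 1) \<noteq> v (i - 1)"
  using distinct_vertices[of i "i + 1"] distinct_vertices[of "i - 1" i] distinct_vertices[of "i - 1" "i + 1"] three_le
  by auto

text \<open>A convex combination of vertices that lies on the supporting line gives no weight to the
  vertices off that line.\<close>

lemma supporting_face: "polygon \<inter> {x. e i \<bullet> x = 1} = closed_segment (v (i - 1)) (v i)"
proof
  show "closed_segment (v (i - 1)) (v i) \<subseteq> polygon \<inter> {x. e i \<bullet> x = 1}"
    using vertex_mem by (intro closed_segment_subset) (auto intro: convex_Int convex_hyperplane)
  show "polygon \<inter> {x. e i \<bullet> x = 1} \<subseteq> closed_segment (v (i - 1)) (v i)"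
  proof clarify
    fix x assume x: "x \<in> polygon" "e i \<bullet> x = 1"
    obtain c where c: "\<forall>y\<in>range v. 0 \<le> c y" "sum c (range v) = 1" "(\<Sum>y\<in>range v. c y *\<^sub>R y) = x"
      using x(1) finite_range by (auto simp: convex_hull_finite)
    have "(\<Sum>y\<in>range v. c y * (1 - e i \<bullet> y)) = 1 - e i \<bullet> x"
      using c(2) by (simp add: c(3)[symmetric] inner_sum_right right_diff_distrib sum_subtractf)
    then have "(\<Sum>y\<in>range v. c y * (1 - e i \<bullet> y)) = 0" using x(2) by simp
    then have zero: "c y * (1 - e i \<bullet> y) = 0" if "y \<in> range v" for y
      using that c(1) finite_range dual_inner_le
      by (subst (asm) sum_nonneg_eq_0_iff) (auto intro!: mult_nonneg_nonneg)
    have supp: "c y = 0" if "y \<in> range v - {v (i - 1), v i}" for y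
      using that zero[of y] dual_inner_eq_1_cases[of i] by auto
    have ne: "v (i - 1) \<noteq> v i" by (rule neighbours_distinct)
    have "sum c (range v) = sum c {v (i - 1), v i}"
      by (rule sum.mono_neutral_right) (use finite_range supp in auto)
    then have one: "c (v (i - 1)) + c (v i) = 1" using c(2) ne by simp
    have "(\<Sum>y\<in>range v. c y *\<^sub>R y) = (\<Sum>y\<in>{v (i - 1), v i}. c y *\<^sub>R y)"
      by (rule sum.mono_neutral_right) (use finite_range supp in auto)
    then have "x = c (v (i - 1)) *\<^sub>R v (i - 1) + c (v i) *\<^sub>R v i" using c(3) ne by simp
    moreover have "c (v (i - 1)) = 1 - c (v i)" "0 \<le> c (v i)" "0 \<le> c (v (i - 1))" using one c(1) by auto
    ultimately have "x = (1 - c (v i)) *\<^sub>R v (i - 1) + c (v i) *\<^sub>R v i" "0 \<le> c (v i)" "c (v i) \<le> 1" by simp_all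
    then show "x \<in> closed_segment (v (i - 1)) (v i)" unfolding closed_segment_def by blast
  qed
qed

lemma segment_face: "closed_segment (v (i - 1)) (v i) face_of polygon"
  using face_of_Int_supporting_hyperplane_le[of polygon "e i" 1] supporting_face[of i]
  by (simp add: convex_convex_hull) (metis (mono_tags, lifting) mem_Collect_eq polygon_eq supporting_face)

lemma segment_edge: "closed_segment (v i) (v (i + 1)) edge_of polygon"
  using segment_face[of "i + 1"] neighbours_distinct(1)[of i]
  by (simp add: edge_of_def segment_convex_hull aff_dim_convex_hull aff_dim_2)

lemma extreme_points: "{x. x extreme_point_of polygon} = range v"
proof
  show "{x. x extreme_point_of polygon} \<subseteq> range v"
    using extreme_point_of_convex_hull by blast
  have "v i extreme_point_of closed_segment (v (i - 1)) (v i)" for i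
    by (rule extreme_point_of_segment[THEN iffD2]) simp
  then show "range v \<subseteq> {x. x extreme_point_of polygon}"
    using extreme_point_of_face[OF segment_face] by blast
qed

lemma consecutive: "consecutive_vertices m polygon v"
  unfolding consecutive_vertices_def extreme_points bij_betw_def
  using inj_on_window[of 0] range_eq segment_edge by simp

lemma card_extreme_points: "card {x. x extreme_point_of polygon} = m"
  using bij_betw_same_card[of v "{0..<int m}"] consecutive by (simp add: consecutive_vertices_def)

lemma polygon_mem: "polygon \<in> polygons m"
  unfolding polygons_def using card_extreme_points finite_range
  by (auto simp: polytope_convex_hull interior_polygon)

lemma polar_eq: "polar polygon = convex hull (range e)"
proof -
  interpret dual: convex_cycle m e by (rule dual_convex_cycle)
  have "polar polygon = {\<xi>. \<forall>k. v k \<bullet> \<xi> \<le> 1}"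
  proof -
    have "(\<forall>y\<in>polygon. \<xi> \<bullet> y \<le> 1) \<longleftrightarrow> (\<forall>y\<in>range v. \<xi> \<bullet> y \<le> 1)" for \<xi>
    proof
      assume "\<forall>y\<in>range v. \<xi> \<bullet> y \<le> 1"
      then have "polygon \<subseteq> {y. \<xi> \<bullet> y \<le> 1}" by (intro hull_minimal convex_halfspace_le) auto
      then show "\<forall>y\<in>polygon. \<xi> \<bullet> y \<le> 1" by auto
    qed (auto intro: hull_inc)
    then show ?thesis by (auto simp: polar_def inner_commute)
  qed
  also have "\<dots> = {\<xi>. \<forall>k. v (k - 1) \<bullet> \<xi> \<le> 1}"
    by (metis add_diff_cancel_right')
  also have "\<dots> = convex hull (range e)"
    unfolding dual.polygon_eq dual_dual by simp
  finally show ?thesis .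
qed

lemma labelling: "vertex_labelling m polygon (v, e)"
  using consecutive convex_cycle.consecutive[OF dual_convex_cycle]
  by (simp add: vertex_labelling_def polar_eq)

text \<open>A diagonal is not an edge: its end point \<open>v i\<close> has its two neighbours strictly on different
  sides of the line carrying the diagonal, whereas an edge lies on a supporting line.\<close>

lemma edge_imp_neighbour:
  assumes edge: "closed_segment (v i) (v k) edge_of polygon" and ne: "v k \<noteq> v i"
  shows "v k = v (i + 1) \<or> v k = v (i - 1)"
proof (rule ccontr)
  assume not: "\<not> ?thesis"
  obtain k' where k': "v k' = v k" "i \<le> k'" "k' < i + int m"
    by (rule periodic_window[of v m k i]) (use m_pos in auto)
  have bounds: "i + 1 < k'" "k' < i + int m - 1"
    using k' ne not periodic[of "i - 1"]
    by (auto simp: order.order_iff_strict algebra_simps) (smt (verit) periodic_minus)+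
  have left: "0 < triangle_det (v (i - 1)) (v i) (v k)"
    using left_of_edge[of i k'] bounds k'(1) by simp
  have right: "0 < triangle_det (v i) (v (i + 1)) (v k)"
    using left_of_edge[of "i + 1" k'] bounds k'(1) by simp
  have "closed_segment (v i) (v k) exposed_face_of polygon"
    using edge exposed_face_of_polyhedron[of polygon] finite_range
    by (metis edge_of_def polytope_convex_hull polytope_imp_polyhedron)
  then obtain a b where ab: "polygon \<subseteq> {x. a \<bullet> x \<le> b}" "closed_segment (v i) (v k) = polygon \<inter> {x. a \<bullet> x = b}"
    unfolding exposed_face_of_def by blast
  have on: "a \<bullet> v i = b" "a \<bullet> v k = b" using ab(2) by (auto simp: set_eq_iff)
  have below: "a \<bullet> v j \<le> b" for j using ab(1) vertex_mem by auto
  define w where "w = v k - v i"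
  \<comment> \<open>A linear form that vanishes on \<open>w\<close> is a multiple of \<open>det2 w\<close>.\<close>
  have scaled: "(w \<bullet> w) * (a \<bullet> (v j - v i)) = det2 w a * det2 w (v j - v i)" for j
  proof -
    have "a \<bullet> w = 0" using on by (simp add: w_def inner_diff_right)
    moreover have "(w \<bullet> w) * (a \<bullet> x) = (a \<bullet> w) * (w \<bullet> x) + det2 w a * det2 w x" for x
      by (simp add: inner_real2 det2_def algebra_simps)
    ultimately show ?thesis by simp
  qed
  have w_pos: "0 < w \<bullet> w" using ne by (simp add: w_def)
  have nonpos: "det2 w a * det2 w (v j - v i) \<le> 0" for j
    unfolding scaled[symmetric] using below[of j] on by (simp add: inner_diff_right mult_le_0_iff)
  have sides: "0 < - det2 w (v (i + 1) - v i)" "0 < det2 w (v (i - 1) - v i)"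
    using left right by (simp_all add: w_def triangle_det_def det2_def algebra_simps)
  then have "det2 w a = 0" using nonpos[of "i + 1"] nonpos[of "i - 1"]
    by (simp add: mult_le_0_iff)
  then have "a \<bullet> (v j - v i) = 0" for j using scaled[of j] w_pos by simp
  then have "a \<bullet> v j = b" for j using on by (simp add: inner_diff_right)
  then have "range v \<subseteq> closed_segment (v i) (v k)" using ab(2) vertex_mem by auto
  then have "v (i + 1) \<in> closed_segment (v i) (v k)" by blast
  then obtain t where "v (i + 1) = (1 - t) *\<^sub>R v i + t *\<^sub>R v k" by (auto simp: closed_segment_def)
  then have "v (i + 1) - v i = t *\<^sub>R w" by (simp add: w_def algebra_simps)
  then have "det2 w (v (i + 1) - v i) = 0" by (simp add: det2_linear)
  then show False using sides by simp
qed

end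

section \<open>The functional in terms of vertices\<close>

definition cycle_functional :: "nat \<Rightarrow> (int \<Rightarrow> real^2) \<Rightarrow> real" where
  "cycle_functional m v =
     (\<Sum>j\<in>{0..<int m}. ln (triangle_det (v (j - 1)) (v j) (v (j + 1))) - ln (det2 (v (j - 1)) (v j)))"

text \<open>A walk on a cycle that never turns back keeps its initial direction.\<close>

lemma cyclic_walk:
  fixes u w :: "int \<Rightarrow> 'a"
  assumes "0 < m" and u: "\<And>i. u (i + int m) = u i" and w: "\<And>i. w (i + int m) = w i"
    and start: "w 0 = u s" "w 1 = u (s + 1)"
    and step: "\<And>i k. w i = u k \<Longrightarrow> w (i + 1) = u (k + 1) \<or> w (i + 1) = u (k - 1)"
    and turn: "\<And>i. w (i + 1) \<noteq> w (i - 1)"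
  shows "w i = u (s + i)"
proof -
  have nat: "w (int n) = u (s + int n) \<and> w (int n + 1) = u (s + int n + 1)" for n
  proof (induction n)
    case (Suc n)
    have "w (int n + 1 + 1) \<noteq> w (int n)" using turn[of "int n + 1"] by simp
    moreover have "s + int n + 1 - 1 = s + int n" by simp
    ultimately have "w (int n + 1 + 1) = u (s + int n + 1 + 1)"
      using step[of "int n + 1" "s + int n + 1"] Suc by metis
    then show ?case using Suc by (simp add: add.commute add.left_commute)
  qed (use start in simp)
  obtain i' q where i': "i' = i + q * int m" "0 \<le> i'"
    using window_representative[OF assms(1), of i 0] by metis
  have "w i = w i'" unfolding i'(1) by (simp add: periodic_mult[of w, OF w])
  also have "\<dots> = u (s + i')" using nat[of "nat i'"] i'(2) by simp
  also have "\<dots> = u (s + i)"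
    unfolding i'(1) using periodic_mult[of u m "s + i" q, OF u] by (simp add: add.assoc)
  finally show ?thesis .
qed

lemma periodic_inj_mod:
  assumes "\<And>i. w (i + int m) = w i" "inj_on w {0..<int m}" "0 < m" "w a = w b"
  shows "int m dvd a - b"
proof -
  have red: "w (c mod int m) = w c" for c
    using periodic_mult[of w m c "- (c div int m)", OF assms(1)]
    by (simp add: minus_div_mult_eq_mod)
  then have "w (a mod int m) = w (b mod int m)" using assms(4) by simp
  then have "a mod int m = b mod int m"
    using assms(2,3) by (auto dest!: inj_onD)
  then show ?thesis by (simp add: mod_eq_dvd_iff)
qed

lemma sum_reverse_window:
  fixes g :: "int \<Rightarrow> 'a::ab_group_add"
  assumes "\<And>i. g (i + int m) = g i"
  shows "(\<Sum>j\<in>{1..int m}. g (s - j)) = (\<Sum>j\<in>{0..<int m}. g j)"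
proof -
  have "(\<Sum>j\<in>{1..int m}. g (s - j)) = (\<Sum>j\<in>{0..<int m}. g (j + (s - int m)))"
    by (rule sum.reindex_bij_witness[where i="\<lambda>j. int m - j" and j="\<lambda>j. int m - j"])
      (auto simp: algebra_simps)
  then show ?thesis using periodic_sum_shift[of g m "s - int m", OF assms] by simp
qed

lemma sum_forward_window:
  fixes g :: "int \<Rightarrow> 'a::ab_group_add"
  assumes "\<And>i. g (i + int m) = g i"
  shows "(\<Sum>j\<in>{1..int m}. g (s + j)) = (\<Sum>j\<in>{0..<int m}. g j)"
proof -
  have "(\<Sum>j\<in>{1..int m}. g (s + j)) = (\<Sum>j\<in>{0..<int m}. g (j + (s + 1)))"
    by (rule sum.reindex_bij_witness[where i="\<lambda>j. j + 1" and j="\<lambda>j. j - 1"])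
      (auto simp: algebra_simps)
  then show ?thesis using periodic_sum_shift[of g m "s + 1", OF assms] by simp
qed

context convex_cycle
begin

abbreviation slack_log :: "int \<Rightarrow> real" where
  "slack_log j \<equiv> ln (1 - e (j - 1) \<bullet> v j) + ln (1 - e (j + 2) \<bullet> v j)"

lemma periodic_plus [simp]: "v (i + int m + c) = v (i + c)" "v (c + (i + int m)) = v (c + i)"
  using periodic[of "i + c"] by (simp_all add: algebra_simps)

lemma dual_periodic_plus: "e (i + int m + c) = e (i + c)" "e (i + int m - c) = e (i - c)"
  using dual_periodic[of "i + c"] dual_periodic[of "i - c"] by (simp_all add: algebra_simps)

lemma slack_log_periodic: "slack_log (j + int m) = slack_log j"
  by (simp only: periodic dual_periodic_plus)

text \<open>Of the two slacks at \<open>v j\<close>, one contributes the corner \<open>j - 1\<close> and the edge \<open>j - 1\<close>, the other the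
  corner \<open>j + 1\<close> and the edge \<open>j + 2\<close>; so every corner and every edge occurs twice.\<close>

lemma sum_slack_log: "(\<Sum>j\<in>{0..<int m}. slack_log j) = 2 * cycle_functional m v"
proof -
  define T where "T j = ln (triangle_det (v (j - 1)) (v j) (v (j + 1)))" for j
  define D where "D j = ln (det2 (v (j - 1)) (v j))" for j
  have T: "T (j + int m) = T j" and D: "D (j + int m) = D j" for j
    by (simp_all add: T_def D_def)
  have 1: "ln (1 - e (j - 1) \<bullet> v j) = T (j - 1) - D (j - 1)" for j
    unfolding slack_eq_divide T_def D_def
    using corner_pos[of "j - 1"] det_pos[of "j - 1"] by (simp add: ln_div)
  have 2: "ln (1 - e (j + 2) \<bullet> v j) = T (j + 1) - D (j + 2)" for j
  proof -
    have idx: "j + 2 - 1 = j + 1" "j + 1 - 1 = j" "j + 1 + 1 = j + 2" by simp_all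
    show ?thesis
      using corner_pos[of "j + 1"] det_pos[of "j + 2"]
      unfolding slack_eq_divide T_def D_def idx triangle_det_rotate[of "v (j + 1)" "v (j + 2)" "v j"]
      by (simp add: ln_div)
  qed
  have "(\<Sum>j\<in>{0..<int m}. slack_log j)
    = (\<Sum>j\<in>{0..<int m}. T (j - 1)) - (\<Sum>j\<in>{0..<int m}. D (j - 1))
      + ((\<Sum>j\<in>{0..<int m}. T (j + 1)) - (\<Sum>j\<in>{0..<int m}. D (j + 2)))"
    unfolding 1 2 by (simp add: sum.distrib sum_subtractf)
  also have "\<dots> = 2 * ((\<Sum>j\<in>{0..<int m}. T j) - (\<Sum>j\<in>{0..<int m}. D j))"
    using periodic_sum_shift[of T m "-1", OF T] periodic_sum_shift[of D m "-1", OF D]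
      periodic_sum_shift[of T m 1, OF T] periodic_sum_shift[of D m 2, OF D] by simp
  finally show ?thesis by (simp add: cycle_functional_def T_def D_def sum_subtractf)
qed

text \<open>Any labelling is the given one up to a rotation or a reflection of the indices: the walk \<open>w\<close>
  steps from vertex to neighbouring vertex and never turns back.\<close>

lemma labelling_sum:
  assumes "vertex_labelling m polygon (w, f)"
  shows "(\<Sum>j\<in>{1..int m}. ln (1 - f (j - 1) \<bullet> w j) + ln (1 - f (j + 2) \<bullet> w j)) = 2 * cycle_functional m v"
proof -
  from assms have w: "w (i + int m) = w i" and edge: "closed_segment (w i) (w (i + 1)) edge_of polygon"
    and bij: "bij_betw w {0..<int m} (range v)" and f: "f i \<bullet> w i = 1" "f i \<bullet> w (i - 1) = 1" for i
    unfolding vertex_labelling_def consecutive_vertices_def extreme_points by auto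
  have inj: "inj_on w {0..<int m}" using bij by (simp add: bij_betw_def)
  have ne: "w a \<noteq> w b" if "a < b" "b - a < int m" for a b
    using periodic_inj_mod[of w m b a, OF w inj m_pos] zdvd_not_zless[of "b - a" "int m"] that by auto
  have rng: "w i \<in> range v" for i
    using bij periodic_range[of w m, OF w m_pos] by (auto simp: bij_betw_def)
  have step: "w (i + 1) = v (k + 1) \<or> w (i + 1) = v (k - 1)" if "w i = v k" for i k
  proof -
    obtain l where l: "w (i + 1) = v l" using rng by auto
    show ?thesis
      using edge_imp_neighbour[of k l] edge[of i] ne[of i "i + 1"] that l three_le by auto
  qed
  have turn: "w (i + 1) \<noteq> w (i - 1)" for i using ne[of "i - 1" "i + 1"] three_le by auto
  obtain s where s: "w 0 = v s" using rng[of 0] by auto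
  from step[OF s] consider "w 1 = v (s + 1)" | "w 1 = v (s - 1)" by auto
  then show ?thesis
  proof cases
    case 1
    have wv: "w i = v (s + i)" for i
      by (rule cyclic_walk[of m v w s]) (use m_pos w s 1 step turn in auto)
    have "f i = e (s + i)" for i
      by (rule dual_eqI) (use f[of i] in \<open>simp_all add: wv add.commute add_diff_eq\<close>)
    then have "(\<Sum>j\<in>{1..int m}. ln (1 - f (j - 1) \<bullet> w j) + ln (1 - f (j + 2) \<bullet> w j))
      = (\<Sum>j\<in>{1..int m}. slack_log (s + j))"
      by (simp add: wv add_diff_eq add.assoc)
    then show ?thesis
      using sum_forward_window[of slack_log m s, OF slack_log_periodic] sum_slack_log by simp
  next
    case 2
    have "w i = v (- (- s + i))" for i
    proof (rule cyclic_walk[of m "\<lambda>i. v (- i)" w "- s"])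
      show "v (- (i + int m)) = v (- i)" for i
        using periodic[of "- i - int m"] by simp
      show "w (i + 1) = v (- (k + 1)) \<or> w (i + 1) = v (- (k - 1))" if "w i = v (- k)" for i k
      proof -
        have "- (k + 1) = - k - 1" "- (k - 1) = - k + 1" by simp_all
        then show ?thesis using step[OF that] by metis
      qed
    qed (use m_pos w s 2 turn in auto)
    then have wv: "w i = v (s - i)" for i by simp
    have fe: "f i = e (s - i + 1)" for i
      by (rule dual_eqI) (use f[of i] in \<open>simp_all add: wv algebra_simps\<close>)
    have "(\<Sum>j\<in>{1..int m}. ln (1 - f (j - 1) \<bullet> w j) + ln (1 - f (j + 2) \<bullet> w j))
      = (\<Sum>j\<in>{1..int m}. slack_log (s - j))"
    proof (rule sum.cong)
      fix j :: int
      have "s - (j - 1) + 1 = s - j + 2" "s - (j + 2) + 1 = s - j - 1" by simp_all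
      then show "ln (1 - f (j - 1) \<bullet> w j) + ln (1 - f (j + 2) \<bullet> w j) = slack_log (s - j)"
        by (simp only: fe wv add.commute)
    qed simp
    then show ?thesis
      using sum_reverse_window[of slack_log m s, OF slack_log_periodic] sum_slack_log by simp
  qed
qed

lemma c1_eq: "c1 polygon = cycle_functional m v"
proof -
  obtain w f where wf: "(SOME ve. vertex_labelling m polygon ve) = (w, f)" by fastforce
  then have "vertex_labelling m polygon (w, f)"
    using someI[of "vertex_labelling m polygon", OF labelling] by simp
  from labelling_sum[OF this] show ?thesis
    by (simp add: c1_def card_extreme_points wf)
qed

text \<open>Polarity exchanges the slacks \<open>1 - e (j - 1) \<bullet> v j\<close> with the slacks \<open>1 - e (j + 2) \<bullet> v j\<close>.\<close>

lemma dual_functional: "cycle_functional m e = cycle_functional m v"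
proof -
  interpret dual: convex_cycle m e by (rule dual_convex_cycle)
  have p: "ln (1 - e (j + int m) \<bullet> v (j + int m - 2)) = ln (1 - e j \<bullet> v (j - 2))"
    "ln (1 - e (j + int m) \<bullet> v (j + int m + 1)) = ln (1 - e j \<bullet> v (j + 1))" for j
    by (simp_all only: periodic_plus periodic_minus dual_periodic)
  have "2 * cycle_functional m e =
    (\<Sum>j\<in>{0..<int m}. ln (1 - e j \<bullet> v (j - 2)) + ln (1 - e j \<bullet> v (j + 1)))"
  proof -
    have "j - 1 - 1 = j - 2" "j + 2 - 1 = j + 1" for j :: int by simp_all
    then show ?thesis
      unfolding dual.sum_slack_log[symmetric] dual_dual by (simp only: inner_commute)
  qed
  also have "\<dots> = (\<Sum>j\<in>{0..<int m}. ln (1 - e (j + 2) \<bullet> v j)) + (\<Sum>j\<in>{0..<int m}. ln (1 - e (j - 1) \<bullet> v j))"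
    using periodic_sum_shift[of "\<lambda>j. ln (1 - e j \<bullet> v (j - 2))" m 2, OF p(1)]
      periodic_sum_shift[of "\<lambda>j. ln (1 - e j \<bullet> v (j + 1))" m "-1", OF p(2)]
    by (simp add: sum.distrib)
  also have "\<dots> = 2 * cycle_functional m v"
    unfolding sum_slack_log[symmetric] by (simp add: sum.distrib)
  finally show ?thesis by simp
qed

end

section \<open>Listing the vertices of a polygon by angle\<close>

definition unit_vec :: "real \<Rightarrow> real^2" where
  "unit_vec t = vector [cos t, sin t]"

lemma unit_vec_nth [simp]: "unit_vec t $ 1 = cos t" "unit_vec t $ 2 = sin t"
  by (simp_all add: unit_vec_def)

lemma det2_unit_vec: "det2 (unit_vec s) (unit_vec t) = sin (t - s)"
  by (simp add: det2_def sin_diff algebra_simps)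

lemma inner_unit_vec: "unit_vec s \<bullet> unit_vec t = cos (t - s)"
  by (simp add: inner_real2 cos_diff algebra_simps)

lemma unit_vec_periodic: "unit_vec (t + 2 * pi * of_int k) = unit_vec t"
  using sin_int_2pin[of k] cos_int_2pin[of k] by (simp add: real2_eq_iff sin_add cos_add)

definition angle_of :: "real^2 \<Rightarrow> real" where
  "angle_of x = Arg2pi (Complex (x $ 1) (x $ 2))"

lemma angle_of: "0 \<le> angle_of x" "angle_of x < 2 * pi" "x = norm x *\<^sub>R unit_vec (angle_of x)"
proof -
  let ?z = "Complex (x $ 1) (x $ 2)"
  show "0 \<le> angle_of x" "angle_of x < 2 * pi" by (simp_all add: angle_of_def Arg2pi_ge_0 Arg2pi_lt_2pi)
  have n: "norm ?z = norm x" by (simp add: cmod_def norm_eq_sqrt_inner inner_real2 power2_eq_square)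
  have "?z = of_real (norm x) * exp (\<i> * of_real (angle_of x))"
    using Arg2pi_eq[of ?z] by (simp add: angle_of_def n)
  then have "Re ?z = norm x * cos (angle_of x)" "Im ?z = norm x * sin (angle_of x)"
    by (simp_all add: Re_exp Im_exp flip: cis_conv_exp)
  then show "x = norm x *\<^sub>R unit_vec (angle_of x)" by (simp add: real2_eq_iff)
qed

lemma extreme_point_of_subset: "x extreme_point_of S \<Longrightarrow> x \<in> T \<Longrightarrow> T \<subseteq> S \<Longrightarrow> x extreme_point_of T"
  unfolding extreme_point_of_def by blast

lemma extreme_point_not_in_triangle:
  assumes "q extreme_point_of P" "convex P" "a \<in> P" "b \<in> P" "c \<in> P" "q \<notin> {a, b, c}"
    and "q = \<alpha> *\<^sub>R a + \<beta> *\<^sub>R b + \<gamma> *\<^sub>R c" "0 \<le> \<alpha>" "0 \<le> \<beta>" "0 \<le> \<gamma>" "\<alpha> + \<beta> + \<gamma> = 1"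
  shows False
proof -
  have "convex hull {a, b, c} \<subseteq> P" by (rule hull_minimal) (use assms in auto)
  moreover have "q \<in> convex hull {a, b, c}" unfolding convex_hull_3 using assms(7-) by blast
  ultimately have "q extreme_point_of convex hull {a, b, c}"
    using assms(1) by (blast intro: extreme_point_of_subset)
  then show False using extreme_point_of_convex_hull assms(6) by blast
qed

text \<open>Consecutive angles differ by less than \<open>\<pi>\<close>, as otherwise all vertices would lie in a half-plane
  with the origin on its boundary. If a third vertex \<open>x\<close> were not strictly to the left of the edge
  from \<open>p\<close> to \<open>q\<close>, then, since its angle is not between theirs, \<open>p\<close> or \<open>q\<close> would lie in the triangle
  of the other one, \<open>x\<close> and the origin, and would not be extreme.\<close>

lemma convex_cycle_by_angle:
  fixes v :: "int \<Rightarrow> real^2"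
  assumes m: "3 \<le> m" and per: "\<And>i. v (i + int m) = v i"
    and polar: "\<And>i. v i = r i *\<^sub>R unit_vec (\<phi> i)" and r: "\<And>i. 0 < r i"
    and mono: "strict_mono \<phi>" and turn: "\<And>i. \<phi> (i + int m) = \<phi> i + 2 * pi"
    and P: "convex P" "0 \<in> interior P" "P \<subseteq> convex hull (range v)"
    and ext: "\<And>i. v i extreme_point_of P"
  shows "convex_cycle m v"
proof
  have det: "det2 (v i) (v k) = r i * r k * sin (\<phi> k - \<phi> i)" for i k
    unfolding polar by (simp add: det2_linear det2_unit_vec)
  have inP: "0 \<in> P" "v i \<in> P" for i
    using P(2) interior_subset ext by (auto simp: extreme_point_of_def)
  have not0: "v i \<noteq> 0" for i
    using extreme_point_not_in_interior[OF ext[of i]] P(2) by auto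
  have less: "\<phi> i < \<phi> k" if "i < k" for i k using strict_monoD[OF mono that] .
  have gap: "\<phi> i - \<phi> (i - 1) < pi" for i
  proof (rule ccontr)
    assume "\<not> ?thesis"
    then have ge: "pi \<le> \<phi> i - \<phi> (i - 1)" by simp
    have half: "0 \<le> det2 (v i) (v k)" for k
    proof -
      obtain k' where k': "v k' = v k" "i \<le> k'" "k' < i + int m"
        by (rule periodic_window[of v m k i]) (use m per in auto)
      have "\<phi> i \<le> \<phi> k'" using less[of i k'] k' by (cases "i = k'") auto
      moreover have "\<phi> k' \<le> \<phi> (i - 1) + 2 * pi"
        using less[of k' "i - 1 + int m"] turn[of "i - 1"] k' by (cases "k' = i - 1 + int m") auto
      ultimately have "0 \<le> sin (\<phi> k' - \<phi> i)" using ge by (intro sin_ge_zero) auto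
      then have "0 \<le> det2 (v i) (v k')" unfolding det using r less_imp_le by (intro mult_nonneg_nonneg) auto
      then show ?thesis using k'(1) by simp
    qed
    define n where "n = quarter_turn (v i)"
    have "range v \<subseteq> {x. n \<bullet> x \<ge> 0}" using half by (auto simp: n_def quarter_turn_inner)
    then have "convex hull (range v) \<subseteq> {x. n \<bullet> x \<ge> 0}" by (intro hull_minimal convex_halfspace_ge)
    then have "P \<subseteq> {x. n \<bullet> x \<ge> 0}" using P(3) by blast
    then have "interior P \<subseteq> interior {x. n \<bullet> x \<ge> 0}" by (rule interior_mono)
    moreover have "n \<noteq> 0" using not0[of i] by (auto simp: n_def real2_eq_iff)
    ultimately show False using P(2) by auto
  qed
  show det_pos: "0 < det2 (v (i - 1)) (v i)" for i
    unfolding det using r gap[of i] less[of "i - 1" i] by (intro mult_pos_pos sin_gt_zero) auto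
  show "0 < triangle_det (v (i - 1)) (v i) (v k)" if k: "i < k" "k < i + int m - 1" for i k
  proof (rule ccontr)
    assume neg: "\<not> ?thesis"
    let ?p = "v (i - 1)" and ?q = "v i" and ?x = "v k"
    have D: "0 < det2 ?p ?q" by (rule det_pos)
    have ang: "\<phi> (i - 1) < \<phi> i" "\<phi> i < \<phi> k" "\<phi> k < \<phi> (i - 1) + 2 * pi"
      using less[of "i - 1" i] less[of i k] less[of k "i - 1 + int m"] turn[of "i - 1"] k by auto
    define a where "a = det2 ?x ?q"
    define b where "b = det2 ?p ?x"
    have ab: "det2 ?p ?q \<le> a + b"
      using neg det2_swap[of ?x ?q] det2_swap[of ?x ?p] by (simp add: triangle_det_def a_def b_def)
    have expand: "det2 ?p ?q *\<^sub>R ?x = a *\<^sub>R ?p + b *\<^sub>R ?q"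
      unfolding a_def b_def by (rule det2_expand)
    have distinct: "?q \<noteq> ?x" "?p \<noteq> ?x" "?p \<noteq> ?q"
    proof -
      show "?p \<noteq> ?q" using D by auto
      have "v i' = v k' \<Longrightarrow> i' < k' \<Longrightarrow> \<phi> k' < \<phi> i' + 2 * pi \<Longrightarrow> False" for i' k'
      proof -
        assume eq: "v i' = v k'" and "i' < k'" "\<phi> k' < \<phi> i' + 2 * pi"
        then have range: "0 < \<phi> k' - \<phi> i'" "\<phi> k' - \<phi> i' < 2 * pi" using less[of i' k'] by auto
        have "det2 (v i') (v k') = 0" using eq by simp
        then have "sin (\<phi> k' - \<phi> i') = 0" using r[of i'] r[of k'] by (simp add: det)
        then have "\<phi> k' - \<phi> i' = pi"
          using range sin_gt_zero[of "\<phi> k' - \<phi> i'"] sin_lt_zero[of "\<phi> k' - \<phi> i'"] by linarith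
        then have "v i' \<bullet> v k' = - (r i' * r k')" by (simp add: polar inner_unit_vec)
        moreover have "0 \<le> v i' \<bullet> v k'" unfolding eq by simp
        ultimately show False using mult_pos_pos[OF r[of i'] r[of k']] by simp
      qed
      then show "?q \<noteq> ?x" "?p \<noteq> ?x" using ang k by force+
    qed
    have "a < 0 \<or> b < 0"
    proof (rule ccontr)
      assume "\<not> ?thesis"
      then have "0 \<le> sin (\<phi> i - \<phi> k)" "0 \<le> sin (\<phi> k - \<phi> (i - 1))"
        using r[of i] r[of k] r[of "i - 1"]
        by (auto simp: a_def b_def det zero_le_mult_iff not_less mult_less_0_iff dest: order.asym)
      then have "sin (\<phi> k - \<phi> i) \<le> 0" using sin_minus[of "\<phi> k - \<phi> i"] by simp
      then have "pi \<le> \<phi> k - \<phi> i" using sin_gt_zero[of "\<phi> k - \<phi> i"] ang by linarith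
      moreover have "\<phi> k - \<phi> (i - 1) \<le> pi"
        using sin_lt_zero[of "\<phi> k - \<phi> (i - 1)"] ang \<open>0 \<le> sin (\<phi> k - \<phi> (i - 1))\<close> by linarith
      ultimately show False using ang by linarith
    qed
    then show False
    proof
      assume "a < 0"
      then have b: "0 < b" "det2 ?p ?q - a \<le> b" using ab D by auto
      have "b *\<^sub>R ?q = det2 ?p ?q *\<^sub>R ?x + (- a) *\<^sub>R ?p" using expand by simp
      then have "(1 / b) *\<^sub>R (b *\<^sub>R ?q) = (1 / b) *\<^sub>R (det2 ?p ?q *\<^sub>R ?x + (- a) *\<^sub>R ?p)" by simp
      then have eq: "?q = (det2 ?p ?q / b) *\<^sub>R ?x + (- a / b) *\<^sub>R ?p + (1 - (det2 ?p ?q - a) / b) *\<^sub>R 0"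
        using b by (simp add: scaleR_right_diff_distrib)
      have "(det2 ?p ?q - a) / b \<le> 1" using b by simp
      moreover have "0 \<le> - a / b" using b \<open>a < 0\<close> by (intro divide_nonneg_pos) auto
      moreover have "0 \<le> det2 ?p ?q / b" using b D by simp
      moreover have "det2 ?p ?q / b + - a / b = (det2 ?p ?q - a) / b" by (simp add: diff_divide_distrib)
      ultimately show False
        by (intro extreme_point_not_in_triangle[OF ext P(1) inP(2) inP(2) inP(1) _ eq])
          (use distinct not0 in \<open>auto simp del: minus_divide_left\<close>)
    next
      assume "b < 0"
      then have a: "0 < a" "det2 ?p ?q - b \<le> a" using ab D by auto
      have "a *\<^sub>R ?p = det2 ?p ?q *\<^sub>R ?x + (- b) *\<^sub>R ?q" using expand by simp
      then have "(1 / a) *\<^sub>R (a *\<^sub>R ?p) = (1 / a) *\<^sub>R (det2 ?p ?q *\<^sub>R ?x + (- b) *\<^sub>R ?q)" by simp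
      then have eq: "?p = (det2 ?p ?q / a) *\<^sub>R ?x + (- b / a) *\<^sub>R ?q + (1 - (det2 ?p ?q - b) / a) *\<^sub>R 0"
        using a by (simp add: scaleR_right_diff_distrib)
      have "(det2 ?p ?q - b) / a \<le> 1" using a by simp
      moreover have "0 \<le> - b / a" using a \<open>b < 0\<close> by (intro divide_nonneg_pos) auto
      moreover have "0 \<le> det2 ?p ?q / a" using a D by simp
      moreover have "det2 ?p ?q / a + - b / a = (det2 ?p ?q - b) / a" by (simp add: diff_divide_distrib)
      ultimately show False
        by (intro extreme_point_not_in_triangle[OF ext P(1) inP(2) inP(2) inP(1) _ eq])
          (use distinct not0 in \<open>auto simp del: minus_divide_left\<close>)
    qed
  qed
qed (use m per in auto)

text \<open>Of two points on a ray from the origin, the nearer one lies between the origin and the other one,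
  and so is not extreme.\<close>

lemma inj_on_angle_of_extreme_points:
  assumes "convex P" "0 \<in> interior P"
  shows "inj_on angle_of {x. x extreme_point_of P}"
proof (rule inj_onI, clarsimp)
  fix x y assume x: "x extreme_point_of P" and y: "y extreme_point_of P" and eq: "angle_of x = angle_of y"
  have pos: "0 < norm x" "0 < norm y"
    using extreme_point_not_in_interior x y assms(2) by auto
  have no: False if "p extreme_point_of P" "q extreme_point_of P" "angle_of p = angle_of q"
    "norm p < norm q" "0 < norm p" for p q
  proof -
    have "norm q \<noteq> 0" using that(4,5) by auto
    moreover have "(a / c) *\<^sub>R (c *\<^sub>R u) = a *\<^sub>R u" if "c \<noteq> 0" for a c and u :: "real^2"
      using that by simp
    ultimately have "(norm p / norm q) *\<^sub>R (norm q *\<^sub>R unit_vec (angle_of q)) = norm p *\<^sub>R unit_vec (angle_of q)"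
      by blast
    then have "(norm p / norm q) *\<^sub>R q = norm p *\<^sub>R unit_vec (angle_of q)"
      unfolding angle_of(3)[of q, symmetric] .
    then have "p = (norm p / norm q) *\<^sub>R q" using angle_of(3)[of p] that(3) by simp
    then have "p = (1 - norm p / norm q) *\<^sub>R 0 + (norm p / norm q) *\<^sub>R q" by simp
    moreover have "0 < a / c" "a / c < 1" if "a < c" "0 < a" for a c :: real using that by auto
    note this[OF that(4,5)]
    moreover have "0 \<noteq> q" using that(4,5) by auto
    ultimately have "p \<in> open_segment 0 q" unfolding in_segment by blast
    then show False
      using that(1,2) assms(2) interior_subset unfolding extreme_point_of_def by blast
  qed
  have "norm x = norm y" using no[of x y] no[of y x] x y eq pos by fastforce
  then show "x = y" using angle_of(3)[of x] angle_of(3)[of y] eq by simp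
qed

text \<open>Sort the angles of the vertices and continue the enumeration by adding \<open>2\<pi>\<close> per turn.\<close>

theorem polygons_obtain_cycle:
  assumes P: "P \<in> polygons m" and m: "3 \<le> m"
  obtains v where "convex_cycle m v" "P = convex hull (range v)"
proof -
  define S where "S = {x. x extreme_point_of P}"
  have poly: "polytope P" and card: "card S = m" and int0: "0 \<in> interior P"
    using P by (auto simp: polygons_def S_def)
  have conv: "convex P" "compact P" using poly by (auto simp: polytope_imp_convex polytope_imp_compact)
  have hull: "P = convex hull S" unfolding S_def using conv by (intro Krein_Milman_Minkowski)
  have fin: "finite S" using card m by (intro card_ge_0_finite) simp
  have inj: "inj_on angle_of S"
    unfolding S_def by (rule inj_on_angle_of_extreme_points[OF conv(1) int0])
  define xs where "xs = sorted_list_of_set (angle_of ` S)"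
  have len: "length xs = m" using fin card inj by (simp add: xs_def card_image)
  have set_xs: "set xs = angle_of ` S" using fin by (simp add: xs_def)
  have sorted: "sorted_wrt (<) xs" by (simp add: xs_def strict_sorted_list_of_set)
  define \<theta> where "\<theta> j = xs ! nat j" for j :: int
  have \<theta>_mem: "\<theta> j \<in> angle_of ` S" if "0 \<le> j" "j < int m" for j
    using that len set_xs by (auto simp: \<theta>_def)
  have \<theta>_range: "0 \<le> \<theta> j" "\<theta> j < 2 * pi" if "0 \<le> j" "j < int m" for j
    using \<theta>_mem[OF that] angle_of by auto
  have \<theta>_less: "\<theta> j < \<theta> k" if "0 \<le> j" "j < k" "k < int m" for j k
    unfolding \<theta>_def using that len by (intro sorted_wrt_nth_less[OF sorted]) auto
  have mod: "0 \<le> i mod int m" "i mod int m < int m" for i using m by auto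
  define v where "v i = inv_into S angle_of (\<theta> (i mod int m))" for i
  define \<phi> where "\<phi> i = \<theta> (i mod int m) + 2 * pi * of_int (i div int m)" for i
  have angle_v: "angle_of (v i) = \<theta> (i mod int m)" for i
    unfolding v_def by (rule f_inv_into_f) (rule \<theta>_mem[OF mod])
  have v_mem: "v i \<in> S" for i unfolding v_def by (rule inv_into_into) (rule \<theta>_mem[OF mod])
  have range_v: "range v = S"
  proof
    show "range v \<subseteq> S" using v_mem by blast
    show "S \<subseteq> range v"
    proof
      fix x assume x: "x \<in> S"
      then obtain n where n: "n < m" "angle_of x = xs ! n"
        using set_xs len by (metis image_eqI in_set_conv_nth)
      then have "angle_of (v (int n)) = angle_of x" by (simp add: angle_v \<theta>_def)
      then show "x \<in> range v" using inj x v_mem by (metis inj_onD rangeI)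
    qed
  qed
  have not0: "v i \<noteq> 0" for i
    using v_mem[of i] extreme_point_not_in_interior[of "v i" P] int0 by (auto simp: S_def)
  have "convex_cycle m v"
  proof (rule convex_cycle_by_angle[of m v "\<lambda>i. norm (v i)" \<phi> P])
    show "v (i + int m) = v i" for i by (simp add: v_def)
    show "v i = norm (v i) *\<^sub>R unit_vec (\<phi> i)" for i
      unfolding \<phi>_def unit_vec_periodic using angle_of(3)[of "v i"] angle_v[of i] by simp
    show "strict_mono \<phi>"
    proof
      fix i k :: int assume "i < k"
      show "\<phi> i < \<phi> k"
      proof (cases "i div int m = k div int m")
        case True
        then have "i mod int m < k mod int m"
          using \<open>i < k\<close> by (metis add_less_cancel_left mult_div_mod_eq)
        then show ?thesis using \<theta>_less[OF mod(1) _ mod(2)] by (simp add: \<phi>_def True)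
      next
        case False
        then have "i div int m + 1 \<le> k div int m" using zdiv_mono1[of i k "int m"] \<open>i < k\<close> m by auto
        then have "of_int (i div int m) + 1 \<le> (of_int (k div int m) :: real)" by linarith
        then have "2 * pi * (of_int (i div int m) + 1) \<le> 2 * pi * of_int (k div int m)" by simp
        then show ?thesis
          using \<theta>_range[OF mod, of i] \<theta>_range[OF mod, of k] by (simp add: \<phi>_def algebra_simps)
      qed
    qed
    show "\<phi> (i + int m) = \<phi> i + 2 * pi" for i
      using m by (simp add: \<phi>_def algebra_simps)
    show "P \<subseteq> convex hull (range v)" using hull range_v by simp
    show "v i extreme_point_of P" for i using v_mem[of i] by (simp add: S_def)
  qed (use m not0 conv int0 in auto)
  with hull range_v that show ?thesis by simp
qed

section \<open>Linear images\<close>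

lemma triangle_det_matrix: "triangle_det (A *v a) (A *v b) (A *v c) = det A * triangle_det a b c"
  by (simp add: triangle_det_def det2_matrix algebra_simps)

lemma (in convex_cycle) linear_image_cycle:
  assumes "0 < det A"
  shows "convex_cycle m (\<lambda>i. A *v v i)"
  by unfold_locales
    (use three_le det_pos left_of_edge assms in \<open>auto simp: det2_matrix triangle_det_matrix\<close>)

lemma (in convex_cycle) linear_image_functional:
  assumes "0 < det A"
  shows "cycle_functional m (\<lambda>i. A *v v i) = cycle_functional m v"
  unfolding cycle_functional_def det2_matrix triangle_det_matrix
  using assms corner_pos det_pos by (intro sum.cong) (auto simp: ln_mult_pos)

lemma convex_hull_matrix_image: "convex hull (range (\<lambda>i. A *v f i)) = (\<lambda>x. A *v x) ` (convex hull (range f))"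
  for A :: "real^2^2"
  using convex_hull_linear_image[of "(*v) A" "range f"] by (simp add: image_image)

section \<open>The regular polygon\<close>

definition regular_cycle :: "nat \<Rightarrow> int \<Rightarrow> real^2" where
  "regular_cycle m j = unit_vec (2 * pi * of_int j / of_nat m)"

lemma triangle_det_unit_vec:
  "triangle_det (unit_vec a) (unit_vec b) (unit_vec c)
    = 4 * sin ((b - a) / 2) * sin ((c - b) / 2) * sin ((c - a) / 2)"
proof -
  define x y where "x = (b - a) / 2" and "y = (c - b) / 2"
  have "triangle_det (unit_vec a) (unit_vec b) (unit_vec c) = sin (2 * x) + sin (2 * y) - sin (2 * (x + y))"
  proof -
    have "2 * x = b - a" "2 * y = c - b" "2 * (x + y) = c - a"
      by (simp_all add: x_def y_def field_simps)
    then show ?thesis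
      using sin_minus[of "c - a"] by (simp only: triangle_det_def det2_unit_vec) simp
  qed
  also have "\<dots> = 4 * sin x * sin y * sin (x + y)"
  proof -
    have "2 * a * c + 2 * b * d - 2 * (a * d + c * b) * (c * d - a * b) = 4 * a * b * (a * d + c * b)"
      if "c * c = 1 - a * a" "d * d = 1 - b * b" for a b c d :: real
    proof -
      have "(a * d + c * b) * (c * d - a * b) = a * c * (d * d) + b * d * (c * c) - a * a * b * d - a * c * b * b"
        by (simp add: algebra_simps)
      then show ?thesis unfolding that by (simp add: algebra_simps)
    qed
    from this[of "cos x" "sin x" "cos y" "sin y"] show ?thesis
      unfolding sin_double sin_add cos_add by (simp add: cos_squared_eq flip: power2_eq_square)
  qed
  also have "x + y = (c - a) / 2" by (simp add: x_def y_def field_simps)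
  finally show ?thesis by (simp add: x_def y_def)
qed

lemma regular_cycle_periodic: "0 < m \<Longrightarrow> regular_cycle m (i + int m) = regular_cycle m i"
  using unit_vec_periodic[of "2 * pi * of_int i / of_nat m" 1]
  by (simp add: regular_cycle_def add_divide_distrib algebra_simps)

lemma regular_convex_cycle:
  assumes "3 \<le> m"
  shows "convex_cycle m (regular_cycle m)"
proof
  define t where "t = 2 * pi / m"
  have t: "0 < t" "t < pi" "t * m = 2 * pi" using assms by (auto simp: t_def field_simps)
  have reg: "regular_cycle m i = unit_vec (of_int i * t)" for i
    by (simp add: regular_cycle_def t_def field_simps)
  show "0 < det2 (regular_cycle m (i - 1)) (regular_cycle m i)" for i
    using t by (simp add: reg det2_unit_vec left_diff_distrib sin_gt_zero)
  show "0 < triangle_det (regular_cycle m (i - 1)) (regular_cycle m i) (regular_cycle m k)"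
    if "i < k" "k < i + int m - 1" for i k
  proof -
    have 1: "of_int i * t < of_int k * t" using t that by (intro mult_strict_right_mono) auto
    have "(of_int k - of_int i + 1) * t < real m * t"
      using t that by (intro mult_strict_right_mono) linarith+
    then have 2: "of_int k * t - of_int i * t + t < 2 * pi" using t(3) by (simp add: algebra_simps)
    have 3: "of_int (i - 1) * t = of_int i * t - t" by (simp add: left_diff_distrib)
    have *: "0 < (of_int k * t - of_int i * t) / 2" "(of_int k * t - of_int (i - 1) * t) / 2 < pi"
      "(of_int k * t - of_int i * t) / 2 < pi" "0 < (of_int k * t - of_int (i - 1) * t) / 2"
      "0 < (of_int i * t - of_int (i - 1) * t) / 2" "(of_int i * t - of_int (i - 1) * t) / 2 < pi"
    proof -
      have "0 < (y - x) / 2" "(y - (x - t)) / 2 < pi" "(y - x) / 2 < pi" "0 < (y - (x - t)) / 2"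
        "0 < (x - (x - t)) / 2" "(x - (x - t)) / 2 < pi" if "x < y" "y - x + t < 2 * pi" for x y
        using that t by simp_all
      note this[OF 1 2]
      then show "0 < (of_int k * t - of_int i * t) / 2" "(of_int k * t - of_int (i - 1) * t) / 2 < pi"
        "(of_int k * t - of_int i * t) / 2 < pi" "0 < (of_int k * t - of_int (i - 1) * t) / 2"
        "0 < (of_int i * t - of_int (i - 1) * t) / 2" "(of_int i * t - of_int (i - 1) * t) / 2 < pi"
        unfolding 3 by blast+
    qed
    show ?thesis
      unfolding reg triangle_det_unit_vec
      using sin_gt_zero[OF *(1,3)] sin_gt_zero[OF *(4,2)] sin_gt_zero[OF *(5,6)] by simp
  qed
qed (use assms regular_cycle_periodic in auto)

lemma regular_polygon_eq:
  assumes "0 < m"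
  shows "regular_polygon m = convex hull (range (regular_cycle m))"
proof -
  have "range (regular_cycle m) = regular_cycle m ` {0..<int m}"
    by (rule periodic_range) (use regular_cycle_periodic assms in auto)
  also have "\<dots> = {vector [cos (2 * pi * real k / real m), sin (2 * pi * real k / real m)] |k. k < m}"
  proof -
    have "{0..<int m} = int ` {..<m}" by (simp add: image_int_atLeastLessThan lessThan_atLeast0)
    then show ?thesis by (auto simp: regular_cycle_def unit_vec_def image_image)
  qed
  finally show ?thesis by (simp add: regular_polygon_def)
qed

text \<open>The cycle satisfies \<open>v (i + 1) = l *\<^sub>R v i - v (i - 1)\<close> with \<open>l = f / d\<close>. Positivity of a corner gives
  \<open>l < 2\<close>, and the triangle of \<open>v 0\<close>, \<open>v 1\<close>, \<open>v 3\<close> gives \<open>l \<ge> -1\<close>; hence \<open>l = 2 cos t\<close> and the recurrence is a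
  rotation by \<open>t\<close> in suitable coordinates. By periodicity \<open>t = 2\<pi>w/m\<close>, and for \<open>w \<ge> 2\<close> the cycle would be a
  star polygon or a multiple cover, which is not convex.\<close>

theorem (in convex_cycle) regular_if_constant:
  assumes d: "\<And>i. det2 (v (i - 1)) (v i) = d" and f: "\<And>i. det2 (v (i - 1)) (v (i + 1)) = f"
  shows "\<exists>A :: real^2^2. 0 < det A \<and> v = (\<lambda>i. A *v regular_cycle m i)"
proof -
  have d_pos: "0 < d" using det_pos[of 1] d[of 1] by simp
  define l where "l = f / d"
  have f_eq: "f = l * d" using d_pos by (simp add: l_def)
  have rec: "v (i + 1) = l *\<^sub>R v i - v (i - 1)" for i
  proof -
    have "f *\<^sub>R v i = d *\<^sub>R v (i - 1) + d *\<^sub>R v (i + 1)"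
      using det2_expand[of "v (i - 1)" "v (i + 1)" "v i"] d[of i] d[of "i + 1"] f[of i] by simp
    then have "d *\<^sub>R (v (i + 1)) = d *\<^sub>R (l *\<^sub>R v i - v (i - 1))"
      by (simp add: f_eq algebra_simps)
    then show ?thesis using d_pos by simp
  qed
  have d01: "det2 (v 0) (v 1) = d" "det2 (v 1) (v 0) = - d"
    using d[of 1] det2_swap[of "v 1" "v 0"] by simp_all
  have v2: "v 2 = l *\<^sub>R v 1 - v 0" using rec[of 1] by simp
  have v3: "v 3 = l *\<^sub>R v 2 - v 1" using rec[of 2] by simp
  have l_less: "l < 2"
  proof -
    have "0 < triangle_det (v 0) (v 1) (v 2)" using corner_pos[of 1] by simp
    also have "\<dots> = d * (2 - l)"
      using d01 by (simp add: triangle_det_def v2 det2_linear algebra_simps)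
    finally show ?thesis using d_pos by (simp add: zero_less_mult_iff)
  qed
  have l_ge: "-1 \<le> l"
  proof -
    have "0 \<le> triangle_det (v 0) (v 1) (v 3)"
    proof (cases "m = 3")
      case True
      then have "v 3 = v 0" using periodic[of 0] by simp
      then show ?thesis using det2_swap[of "v 0" "v 1"] by (simp add: triangle_det_def)
    next
      case False
      then show ?thesis using left_of_edge[of 1 3] three_le by simp
    qed
    also have "triangle_det (v 0) (v 1) (v 3) = d * ((2 - l) * (1 + l))"
      using d01
      by (simp add: triangle_det_def v2 v3 det2_linear algebra_simps)
    finally show ?thesis using d_pos l_less by (simp add: zero_le_mult_iff)
  qed
  define t where "t = arccos (l / 2)"
  have cos_t: "cos t = l / 2" using l_less l_ge by (simp add: t_def cos_arccos)
  have t: "0 < t" "t < pi"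
    using arccos_lt_bounded[of "l / 2"] l_less l_ge by (auto simp: t_def)
  have sin_t: "0 < sin t" by (rule sin_gt_zero[OF t])
  define b where "b = (v 1 - cos t *\<^sub>R v 0) /\<^sub>R sin t"
  define A :: "real^2^2" where "A = vector [vector [v 0 $ 1, b $ 1], vector [v 0 $ 2, b $ 2]]"
  have A: "A *v unit_vec s = cos s *\<^sub>R v 0 + sin s *\<^sub>R b" for s
    by (simp add: A_def real2_eq_iff matrix_vector_mult_def sum_2)
  have det_A: "det A = det2 (v 0) b" by (simp add: A_def det_2 det2_def)
  have "sin t * det2 (v 0) b = d" using d01 sin_t by (simp add: b_def det2_linear)
  then have "0 < sin t * det2 (v 0) b" using d_pos by simp
  then have det_A_pos: "0 < det A" unfolding det_A using sin_t by (rule zero_less_mult_pos)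
  have step: "v (int n) = A *v unit_vec (real n * t) \<and> v (int n + 1) = A *v unit_vec (real (Suc n) * t)" for n
  proof (induction n)
    case 0
    show ?case using sin_t by (simp add: A b_def)
  next
    case (Suc n)
    have "cos (real (Suc (Suc n)) * t) = 2 * cos t * cos (real (Suc n) * t) - cos (real n * t)"
      "sin (real (Suc (Suc n)) * t) = 2 * cos t * sin (real (Suc n) * t) - sin (real n * t)"
    proof -
      have e: "real (Suc (Suc n)) * t = real (Suc n) * t + t" "real n * t = real (Suc n) * t - t"
        by (simp_all add: algebra_simps)
      show "cos (real (Suc (Suc n)) * t) = 2 * cos t * cos (real (Suc n) * t) - cos (real n * t)"
        "sin (real (Suc (Suc n)) * t) = 2 * cos t * sin (real (Suc n) * t) - sin (real n * t)"
        unfolding e by (simp_all add: cos_add sin_add cos_diff sin_diff)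
    qed
    then have "unit_vec (real (Suc (Suc n)) * t) = l *\<^sub>R unit_vec (real (Suc n) * t) - unit_vec (real n * t)"
      by (simp add: real2_eq_iff cos_t)
    then have "A *v unit_vec (real (Suc (Suc n)) * t)
        = l *\<^sub>R (A *v unit_vec (real (Suc n) * t)) - A *v unit_vec (real n * t)"
      by (simp only: matrix_vector_mult_diff_distrib matrix_vector_mult_scaleR)
    also have "\<dots> = v (int n + 1 + 1)" using rec[of "int n + 1"] Suc by simp
    finally show ?case using Suc by (simp add: add.commute)
  qed
  have v_nat: "v (int n) = A *v unit_vec (real n * t)" for n using step[of n] by simp
  have "A *v unit_vec (real m * t) = A *v unit_vec 0"
    using v_nat[of m] v_nat[of 0] periodic[of 0] by simp
  moreover have "inj ((*v) A)"
    using det_A_pos by (simp add: inj_matrix_vector_mult invertible_det_nz)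
  ultimately have "unit_vec (real m * t) = unit_vec 0" by (meson injD)
  then have "cos (real m * t) = 1" by (simp add: real2_eq_iff)
  then obtain w :: int where w: "real m * t = of_int w * 2 * pi" using cos_one_2pi_int by blast
  have "0 < real m * t" using t m_pos by simp
  then have w_pos: "0 < w" unfolding w by (simp add: zero_less_mult_iff)
  have "real_of_int w * 2 * pi < real m * pi"
    using t m_pos by (simp flip: w)
  then have "2 * real_of_int w < real m" by simp
  then have w_less: "2 * w < int m" by linarith
  have t_eq: "t = 2 * pi * of_int w / m" using w m_pos by (simp add: field_simps)
  have "w = 1"
  proof (rule ccontr)
    assume "w \<noteq> 1"
    then have w2: "2 \<le> w" using w_pos by simp
    \<comment> \<open>The first vertex after at least one full turn is not strictly left of the edge from \<open>v 0\<close> to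
      \<open>v 1\<close>.\<close>
    define k where "k = (LEAST k :: nat. int m \<le> int k * w)"
    have ex: "int m \<le> int (m - 1) * w"
    proof -
      have "int m \<le> int (m - 1) * 2" using three_le by simp
      also have "\<dots> \<le> int (m - 1) * w" using w2 by (intro mult_left_mono) auto
      finally show ?thesis .
    qed
    have k_ge: "int m \<le> int k * w" unfolding k_def using ex by (rule LeastI)
    have k_le: "k \<le> m - 1" unfolding k_def using ex by (rule Least_le)
    have k1: "1 < k"
    proof (rule ccontr)
      assume "\<not> 1 < k"
      then have "int k * w \<le> 1 * w" using w_pos by (intro mult_right_mono) auto
      then show False using k_ge w_less w_pos by linarith
    qed
    have k_pred: "int (k - 1) * w < int m"
      using not_less_Least[of "k - 1" "\<lambda>k. int m \<le> int k * w"] k1 by (simp add: k_def not_le)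
    have "0 < triangle_det (v 0) (v 1) (v (int k))"
      using left_of_edge[of 1 "int k"] k1 k_le three_le by simp
    also have "\<dots> = det A * (4 * sin (t / 2) * sin ((real k * t - t) / 2) * sin (real k * t / 2))"
      using v_nat[of 0] v_nat[of 1] v_nat[of k] by (simp add: triangle_det_matrix triangle_det_unit_vec)
    finally have "0 < sin (t / 2) * sin ((real k * t - t) / 2) * sin (real k * t / 2)"
      using det_A_pos by (simp add: zero_less_mult_iff)
    moreover have "0 < sin (t / 2)" using t by (intro sin_gt_zero) auto
    moreover have "0 < sin ((real k * t - t) / 2)"
    proof (rule sin_gt_zero)
      show "0 < (real k * t - t) / 2" using k1 t by simp
      have "real_of_int (int (k - 1) * w) < real_of_int (int m)" using k_pred by (simp only: of_int_less_iff)
      then have "real (k - 1) * of_int w < real m" by simp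
      then have "pi * (real (k - 1) * of_int w) < pi * real m" by simp
      then show "(real k * t - t) / 2 < pi"
        using k1 m_pos by (simp add: t_eq of_nat_diff field_simps)
    qed
    moreover have "sin (real k * t / 2) \<le> 0"
    proof (rule sin_le_zero)
      have "real_of_int (int m) \<le> real_of_int (int k * w)" using k_ge by (simp only: of_int_le_iff)
      then have "real m \<le> real k * of_int w" by simp
      then have "pi * real m \<le> pi * (real k * of_int w)" by simp
      then show "pi \<le> real k * t / 2" using m_pos by (simp add: t_eq field_simps)
      have "int k * w < 2 * int m"
        using k_pred k1 w_less w_pos by (simp add: of_nat_diff left_diff_distrib)
      then have "real_of_int (int k * w) < real_of_int (2 * int m)" by (simp only: of_int_less_iff)
      then have "real k * of_int w < 2 * real m" by simp
      then have "pi * (real k * of_int w) < pi * (2 * real m)" by simp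
      then show "real k * t / 2 < 2 * pi" using m_pos by (simp add: t_eq field_simps)
    qed
    ultimately show False
      using mult_nonneg_nonpos[OF less_imp_le[OF mult_pos_pos[of "sin (t / 2)" "sin ((real k * t - t) / 2)"]]]
      by (meson not_less)
  qed
  then have t_reg: "t = 2 * pi / m" using t_eq by simp
  have "v i = A *v regular_cycle m i" for i
  proof -
    obtain i' where i': "(\<lambda>i. (v i, regular_cycle m i)) i' = (v i, regular_cycle m i)" "0 \<le> i'"
      by (rule periodic_window[of "\<lambda>i. (v i, regular_cycle m i)" m i 0])
        (use m_pos regular_cycle_periodic in auto)
    have "v i' = A *v regular_cycle m i'"
      using v_nat[of "nat i'"] i'(2) by (simp add: regular_cycle_def t_reg mult.commute)
    moreover have "v i' = v i" "regular_cycle m i' = regular_cycle m i" using i'(1) by simp_all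
    ultimately show ?thesis by simp
  qed
  then show ?thesis using det_A_pos by blast
qed

section \<open>The first variation\<close>

text \<open>The derivative of \<open>cycle_functional m\<close> at \<open>v\<close> in the direction \<open>z\<close>.\<close>

definition first_variation :: "nat \<Rightarrow> (int \<Rightarrow> real^2) \<Rightarrow> (int \<Rightarrow> real^2) \<Rightarrow> real" where
  "first_variation m v z = (\<Sum>j\<in>{0..<int m}.
     (det2 (z (j - 1)) (v j - v (j + 1)) + det2 (z j) (v (j + 1) - v (j - 1)) + det2 (z (j + 1)) (v (j - 1) - v j))
       / triangle_det (v (j - 1)) (v j) (v (j + 1))
     - (det2 (v (j - 1)) (z j) + det2 (z (j - 1)) (v j)) / det2 (v (j - 1)) (v j))"

text \<open>The coefficient of \<open>z j\<close> in the first variation, as the vector that \<open>det2\<close> pairs with \<open>z j\<close>.\<close>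

definition variation_covector :: "(int \<Rightarrow> real^2) \<Rightarrow> int \<Rightarrow> real^2" where
  "variation_covector v j =
     (v (j - 1) - v (j - 2)) /\<^sub>R triangle_det (v (j - 2)) (v (j - 1)) (v j)
     - (v (j + 1) - v (j - 1)) /\<^sub>R triangle_det (v (j - 1)) (v j) (v (j + 1))
     - (v (j + 1) - v (j + 2)) /\<^sub>R triangle_det (v j) (v (j + 1)) (v (j + 2))
     - v (j - 1) /\<^sub>R det2 (v (j - 1)) (v j) + v (j + 1) /\<^sub>R det2 (v j) (v (j + 1))"

context convex_cycle
begin

lemma functional_has_derivative:
  "((\<lambda>t. cycle_functional m (\<lambda>j. v j + t *\<^sub>R z j)) has_real_derivative first_variation m v z) (at 0)"
proof -
  have det: "det2 (a + t *\<^sub>R x) (b + t *\<^sub>R y) = det2 a b + t * (det2 a y + det2 x b) + t\<^sup>2 * det2 x y"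
    for a b x y t
    by (simp add: det2_def algebra_simps power2_eq_square)
  have tri: "triangle_det (a + t *\<^sub>R x) (b + t *\<^sub>R y) (c + t *\<^sub>R w) = triangle_det a b c
      + t * (det2 x (b - c) + det2 y (c - a) + det2 w (a - b)) + t\<^sup>2 * triangle_det x y w"
    for a b c x y w t
    by (simp add: triangle_det_def det2_def algebra_simps power2_eq_square)
  have ln_quadratic: "((\<lambda>t. ln (a + t * b + t\<^sup>2 * c)) has_real_derivative b / a) (at 0)"
    if "0 < a" for a b c :: real
  proof -
    have "((\<lambda>t. a + t * b + t\<^sup>2 * c) has_real_derivative b) (at 0)"
      by (rule derivative_eq_intros refl | simp)+
    from DERIV_ln_divide[THEN DERIV_chain2, OF _ this] that show ?thesis by simp
  qed
  show ?thesis
    unfolding cycle_functional_def first_variation_def det tri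
    by (intro DERIV_sum DERIV_diff ln_quadratic corner_pos det_pos)
qed

lemma eventually_convex_cycle:
  assumes z: "\<And>i. z (i + int m) = z i"
  shows "\<forall>\<^sub>F t in nhds 0. convex_cycle m (\<lambda>j. v j + t *\<^sub>R z j)"
proof -
  define w where "w t j = v j + t *\<^sub>R z j" for t j
  have lim: "((\<lambda>t. w t j $ n) \<longlongrightarrow> v j $ n) (nhds 0)" for j n
  proof -
    have "((\<lambda>t. v j $ n + t * z j $ n) \<longlongrightarrow> v j $ n + 0 * z j $ n) (nhds 0)"
      by (intro tendsto_intros filterlim_ident)
    then show ?thesis by (simp add: w_def)
  qed
  have det: "\<forall>\<^sub>F t in nhds 0. 0 < det2 (w t (i - 1)) (w t i)" for i
  proof (rule order_tendstoD(1)[OF _ det_pos[of i]])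
    show "((\<lambda>t. det2 (w t (i - 1)) (w t i)) \<longlongrightarrow> det2 (v (i - 1)) (v i)) (nhds 0)"
      unfolding det2_def by (intro tendsto_intros lim)
  qed
  have tri: "\<forall>\<^sub>F t in nhds 0. 0 < triangle_det (w t (i - 1)) (w t i) (w t k)"
    if "i < k" "k < i + int m - 1" for i k
  proof (rule order_tendstoD(1)[OF _ left_of_edge[OF that]])
    show "((\<lambda>t. triangle_det (w t (i - 1)) (w t i) (w t k)) \<longlongrightarrow> triangle_det (v (i - 1)) (v i) (v k)) (nhds 0)"
      unfolding triangle_det_def det2_def by (intro tendsto_intros lim)
  qed
  have "\<forall>\<^sub>F t in nhds 0. \<forall>i\<in>{0..<int m}. 0 < det2 (w t (i - 1)) (w t i) \<and>
      (\<forall>k\<in>{i<..<i + int m - 1}. 0 < triangle_det (w t (i - 1)) (w t i) (w t k))"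
    using det tri by (intro eventually_ball_finite eventually_conj ballI) auto
  then show ?thesis
  proof eventually_elim
    case (elim t)
    have per: "w t (i + q * int m) = w t i" for i q
      by (rule periodic_mult) (simp add: w_def z)
    have "0 < det2 (w t (i - 1)) (w t i) \<and>
      (\<forall>k. i < k \<longrightarrow> k < i + int m - 1 \<longrightarrow> 0 < triangle_det (w t (i - 1)) (w t i) (w t k))" for i
    proof -
      obtain i' q where i': "i' = i + q * int m" "0 \<le> i'" "i' < int m"
        using window_representative[OF m_pos, of i 0] by (metis add_0)
      have eq: "w t i' = w t i" "w t (i' - 1) = w t (i - 1)"
        using per[of i q] per[of "i - 1" q] i'(1) by (simp_all add: algebra_simps)
      have "0 < triangle_det (w t (i - 1)) (w t i) (w t k)" if "i < k" "k < i + int m - 1" for k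
      proof -
        have "k + q * int m \<in> {i'<..<i' + int m - 1}" using that i'(1) by simp
        then have "0 < triangle_det (w t (i' - 1)) (w t i') (w t (k + q * int m))" using elim i' by auto
        then show ?thesis by (simp add: eq per)
      qed
      moreover have "0 < det2 (w t (i' - 1)) (w t i')" using elim i' by auto
      ultimately show ?thesis by (simp add: eq)
    qed
    then show ?case
      unfolding w_def[symmetric] using three_le by unfold_locales (auto simp: w_def z)
  qed
qed

lemma variation_covector_periodic: "variation_covector v (j + int m) = variation_covector v j"
  unfolding variation_covector_def by (simp only: periodic periodic_plus periodic_minus)

lemma first_variation_by_parts:
  assumes z: "\<And>i. z (i + int m) = z i"
  shows "first_variation m v z = (\<Sum>j\<in>{0..<int m}. det2 (variation_covector v j) (z j))"
proof -
  define T where "T j = triangle_det (v (j - 1)) (v j) (v (j + 1))" for j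
  define D where "D j = det2 (v (j - 1)) (v j)" for j
  define a where "a j = det2 (z j) (v (j + 1) - v (j + 2)) / T (j + 1)" for j
  define b where "b j = det2 (z j) (v (j + 1) - v (j - 1)) / T j" for j
  define c where "c j = det2 (z j) (v (j - 2) - v (j - 1)) / T (j - 1)" for j
  define g where "g j = det2 (v (j - 1)) (z j) / D j" for j
  define h where "h j = det2 (z j) (v (j + 1)) / D (j + 1)" for j
  have T: "T (j + int m) = T j" "T (j + int m + 1) = T (j + 1)" "T (j + int m - 1) = T (j - 1)" for j
    using periodic[of "j - 2"] periodic[of "j + 2"] by (simp_all add: T_def algebra_simps)
  have D: "D (j + int m) = D j" "D (j + int m + 1) = D (j + 1)" for j
    by (simp_all add: D_def algebra_simps)
  have per: "a (j + int m) = a j" "c (j + int m) = c j" "h (j + int m) = h j" for j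
    by (simp_all add: a_def c_def h_def z T D)
  have "first_variation m v z = (\<Sum>j\<in>{0..<int m}. a (j - 1) + b j + c (j + 1) - (g j + h (j - 1)))"
    unfolding first_variation_def
  proof (rule sum.cong)
    fix j :: int
    have idx: "j - 1 + 1 = j" "j - 1 + 2 = j + 1" "j + 1 - 2 = j - 1" "j + 1 - 1 = j" by simp_all
    show "(det2 (z (j - 1)) (v j - v (j + 1)) + det2 (z j) (v (j + 1) - v (j - 1)) + det2 (z (j + 1)) (v (j - 1) - v j))
       / triangle_det (v (j - 1)) (v j) (v (j + 1))
     - (det2 (v (j - 1)) (z j) + det2 (z (j - 1)) (v j)) / det2 (v (j - 1)) (v j)
     = a (j - 1) + b j + c (j + 1) - (g j + h (j - 1))"
      unfolding a_def b_def c_def g_def h_def idx unfolding T_def[symmetric] D_def[symmetric]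
      by (simp add: add_divide_distrib)
  qed simp
  also have "\<dots> = (\<Sum>j\<in>{0..<int m}. a j + b j + c j - (g j + h j))"
    using periodic_sum_shift[of a m "-1", OF per(1)] periodic_sum_shift[of c m 1, OF per(2)]
      periodic_sum_shift[of h m "-1", OF per(3)]
    by (simp add: sum.distrib sum_subtractf)
  also have "\<dots> = (\<Sum>j\<in>{0..<int m}. det2 (variation_covector v j) (z j))"
  proof (rule sum.cong)
    fix j :: int
    have idx: "j - 1 - 1 = j - 2" "j - 1 + 1 = j" "j + 1 - 1 = j" "j + 1 + 1 = j + 2" by simp_all
    show "a j + b j + c j - (g j + h j) = det2 (variation_covector v j) (z j)"
      unfolding a_def b_def c_def g_def h_def variation_covector_def T_def D_def idx
        det2_swap[of _ "z j"]
      by (simp add: det2_linear divide_inverse mult.commute right_diff_distrib)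
  qed simp
  finally show ?thesis .
qed

text \<open>Test with the covectors themselves, turned by a right angle.\<close>

lemma covector_zero_if_critical:
  assumes "\<And>z. (\<And>i. z (i + int m) = z i) \<Longrightarrow> first_variation m v z = 0"
  shows "variation_covector v j = 0"
proof -
  let ?p = "variation_covector v"
  have "first_variation m v (\<lambda>j. quarter_turn (?p j)) = 0"
    by (rule assms) (simp add: variation_covector_periodic)
  then have "(\<Sum>j\<in>{0..<int m}. ?p j \<bullet> ?p j) = 0"
    by (subst (asm) first_variation_by_parts) (simp_all add: variation_covector_periodic det2_quarter_turn)
  then have "\<forall>j\<in>{0..<int m}. ?p j = 0" by (subst (asm) sum_nonneg_eq_0_iff) auto
  moreover obtain j' where "?p j' = ?p j" "0 \<le> j'" "j' < 0 + int m"
    by (rule periodic_window[of ?p m j 0]) (use variation_covector_periodic m_pos in auto)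
  ultimately show ?thesis by auto
qed

text \<open>The direction \<open>(v j \<bullet> x) *\<^sub>R v j\<close> is the velocity of \<open>v j / (1 - t * (v j \<bullet> x))\<close>, the motion that
  translates the polar polygon. The triangle determinants of the moving points are those of the fixed
  ones divided by three such factors, the determinants of edges are divided by two; so one factor
  per vertex remains.\<close>

lemma first_variation_projective:
  "first_variation m v (\<lambda>j. (v j \<bullet> x) *\<^sub>R v j) = (\<Sum>j\<in>{0..<int m}. v j) \<bullet> x"
proof -
  define s where "s j = v j \<bullet> x" for j
  have s: "s (j + int m) = s j" for j by (simp add: s_def)
  have "first_variation m v (\<lambda>j. s j *\<^sub>R v j) = (\<Sum>j\<in>{0..<int m}. s (j + 1))"
    unfolding first_variation_def
  proof (rule sum.cong)
    fix j :: int
    let ?a = "v (j - 1)" and ?b = "v j" and ?c = "v (j + 1)"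
    have "det2 ?b ?c *\<^sub>R ?a + det2 ?c ?a *\<^sub>R ?b + det2 ?a ?b *\<^sub>R ?c = 0"
      by (simp add: real2_eq_iff det2_def algebra_simps)
    then have "(det2 ?b ?c *\<^sub>R ?a + det2 ?c ?a *\<^sub>R ?b + det2 ?a ?b *\<^sub>R ?c) \<bullet> x = 0" by simp
    then have zero: "det2 ?b ?c * s (j - 1) + det2 ?c ?a * s j + det2 ?a ?b * s (j + 1) = 0"
      by (simp add: s_def inner_add_left)
    have "det2 (s (j - 1) *\<^sub>R ?a) (?b - ?c) + det2 (s j *\<^sub>R ?b) (?c - ?a) + det2 (s (j + 1) *\<^sub>R ?c) (?a - ?b)
      = (s (j - 1) + s j + s (j + 1)) * triangle_det ?a ?b ?c"
      using zero det2_swap[of ?a ?b] det2_swap[of ?b ?c] det2_swap[of ?c ?a]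
      by (simp add: det2_linear triangle_det_def algebra_simps)
    moreover have "det2 ?a (s j *\<^sub>R ?b) + det2 (s (j - 1) *\<^sub>R ?a) ?b = (s (j - 1) + s j) * det2 ?a ?b"
      by (simp add: det2_linear algebra_simps)
    ultimately show "(det2 (s (j - 1) *\<^sub>R ?a) (?b - ?c) + det2 (s j *\<^sub>R ?b) (?c - ?a) + det2 (s (j + 1) *\<^sub>R ?c) (?a - ?b))
       / triangle_det ?a ?b ?c - (det2 ?a (s j *\<^sub>R ?b) + det2 (s (j - 1) *\<^sub>R ?a) ?b) / det2 ?a ?b = s (j + 1)"
      using corner_pos[of j] det_pos[of j] by simp
  qed simp
  also have "\<dots> = (\<Sum>j\<in>{0..<int m}. s j)" by (rule periodic_sum_shift_one) (rule s)
  finally show ?thesis by (simp add: s_def inner_sum_left)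
qed

text \<open>All covectors equal one Lagrange multiplier \<open>c\<close>. It vanishes, because at a centred cycle the
  functional is stationary along the projective motions above, which move the sum of the vertices
  in every direction.\<close>

lemma covector_zero_if_constrained_critical:
  assumes crit: "\<And>z. (\<And>i. z (i + int m) = z i) \<Longrightarrow> (\<Sum>j\<in>{0..<int m}. z j) = 0 \<Longrightarrow> first_variation m v z = 0"
    and centred: "(\<Sum>j\<in>{0..<int m}. v j) = 0"
  shows "variation_covector v j = 0"
proof -
  let ?p = "variation_covector v"
  define c where "c = (\<Sum>j\<in>{0..<int m}. ?p j) /\<^sub>R m"
  define q where "q j = ?p j - c" for j
  have q_per: "q (j + int m) = q j" for j by (simp add: q_def variation_covector_periodic)
  have sum_q: "(\<Sum>j\<in>{0..<int m}. q j) = 0"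
    using m_pos by (simp add: q_def sum_subtractf c_def sum_constant_scaleR del: sum_constant)
  have sum_turn: "(\<Sum>j\<in>{0..<int m}. quarter_turn (q j)) = 0"
    using sum_q by (simp add: real2_eq_iff sum_component sum_negf)
  have "first_variation m v (\<lambda>j. quarter_turn (q j)) = 0"
    using crit[of "\<lambda>j. quarter_turn (q j)"] q_per sum_turn by simp
  then have "0 = (\<Sum>j\<in>{0..<int m}. ?p j \<bullet> q j)"
    by (subst (asm) first_variation_by_parts) (simp_all add: q_per det2_quarter_turn)
  also have "\<dots> = (\<Sum>j\<in>{0..<int m}. q j \<bullet> q j) + c \<bullet> (\<Sum>j\<in>{0..<int m}. q j)"
    by (simp add: q_def inner_diff_left sum.distrib[symmetric] inner_sum_right)
  finally have "(\<Sum>j\<in>{0..<int m}. q j \<bullet> q j) = 0" by (simp add: sum_q)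
  then have q0: "q j = 0" if "j \<in> {0..<int m}" for j
    using that by (subst (asm) sum_nonneg_eq_0_iff) auto
  then have p: "?p j = c" if "j \<in> {0..<int m}" for j using that by (force simp: q_def)
  \<comment> \<open>The projective motion along this \<open>x\<close> pairs with the constant covector \<open>c\<close> to a sum of squares.\<close>
  define x where "x = quarter_turn c"
  have "0 = first_variation m v (\<lambda>j. (v j \<bullet> x) *\<^sub>R v j)"
    by (simp add: first_variation_projective centred)
  also have "\<dots> = (\<Sum>j\<in>{0..<int m}. det2 c ((v j \<bullet> x) *\<^sub>R v j))"
    by (subst first_variation_by_parts) (use p in \<open>auto intro!: sum.cong\<close>)
  also have "\<dots> = (\<Sum>j\<in>{0..<int m}. (det2 c (v j))\<^sup>2)"
    by (simp add: x_def det2_linear quarter_turn_inner inner_commute[of "v _"] power2_eq_square)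
  finally have "\<forall>j\<in>{0..<int m}. (det2 c (v j))\<^sup>2 = 0"
    by (subst (asm) eq_commute, subst (asm) sum_nonneg_eq_0_iff) auto
  then have "det2 c (v 0) = 0" "det2 c (v 1) = 0" using three_le by auto
  then have "c = 0"
    using det2_eq_zero_imp[of "v 0" c "v 1"] det_pos[of 1] det2_swap[of c] by fastforce
  moreover obtain j' where "?p j' = ?p j" "0 \<le> j'" "j' < 0 + int m"
    by (rule periodic_window[of ?p m j 0]) (use variation_covector_periodic m_pos in auto)
  ultimately show ?thesis using p[of j'] by simp
qed

end

section \<open>Critical cycles are regular\<close>

text \<open>The covector at the third of five consecutive vertices, paired with the two edges at that vertex.\<close>

lemma five_point_identities:
  fixes A B C D E :: "real^2"
  assumes T: "triangle_det A B C = t1" "triangle_det B C D = t2" "triangle_det C D E = t3"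
    and d: "det2 B C = d2" "det2 C D = d3"
    and nz: "t1 \<noteq> 0" "t2 \<noteq> 0" "t3 \<noteq> 0" "d2 \<noteq> 0" "d3 \<noteq> 0"
    and p: "(B - A) /\<^sub>R t1 - (D - B) /\<^sub>R t2 - (D - E) /\<^sub>R t3 - B /\<^sub>R d2 + D /\<^sub>R d3 = 0"
  shows "det2 (B - A) (D - C) * d2 = det2 B D * t1" "det2 (C - B) (E - D) * d3 = det2 B D * t3"
proof -
  have swap: "det2 D C = - d3" "det2 C B = - d2" "det2 D B = - det2 B D"
    using d det2_swap[of C D] det2_swap[of B C] det2_swap[of B D] by simp_all
  have "0 = det2 ((B - A) /\<^sub>R t1 - (D - B) /\<^sub>R t2 - (D - E) /\<^sub>R t3 - B /\<^sub>R d2 + D /\<^sub>R d3) (D - C)"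
    unfolding p by simp
  also have "\<dots> = det2 (B - A) (D - C) / t1 - det2 (D - B) (D - C) / t2 - det2 (D - E) (D - C) / t3
      - det2 B (D - C) / d2 + det2 D (D - C) / d3"
    by (simp only: det2_linear(1-3) divide_inverse mult.commute)
  also have "det2 (D - B) (D - C) = t2"
    using T(2) swap d by (simp add: det2_linear triangle_det_def)
  also have "det2 (D - E) (D - C) = t3"
    using T(3) swap d det2_swap[of C E] det2_swap[of D E] by (simp add: det2_linear triangle_det_def)
  also have "det2 B (D - C) = det2 B D - d2" by (simp add: det2_linear d)
  also have "det2 D (D - C) = d3" by (simp add: det2_linear swap)
  finally show "det2 (B - A) (D - C) * d2 = det2 B D * t1"
    using nz by (simp add: field_simps)
  have "0 = det2 ((B - A) /\<^sub>R t1 - (D - B) /\<^sub>R t2 - (D - E) /\<^sub>R t3 - B /\<^sub>R d2 + D /\<^sub>R d3) (C - B)"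
    unfolding p by simp
  also have "\<dots> = det2 (B - A) (C - B) / t1 - det2 (D - B) (C - B) / t2 - det2 (D - E) (C - B) / t3
      - det2 B (C - B) / d2 + det2 D (C - B) / d3"
    by (simp only: det2_linear(1-3) divide_inverse mult.commute)
  also have "det2 (B - A) (C - B) = t1"
    using T(1) det2_swap[of A C] by (simp add: det2_linear triangle_det_def)
  also have "det2 (D - B) (C - B) = - t2"
    using T(2) swap d by (simp add: det2_linear triangle_det_def)
  also have "det2 (D - E) (C - B) = det2 (C - B) (E - D)"
    using det2_swap[of "C - B" "D - E"] by (simp add: det2_linear)
  also have "det2 B (C - B) = d2" by (simp add: det2_linear d)
  also have "det2 D (C - B) = det2 B D - d3" by (simp add: det2_linear swap)
  finally show "det2 (C - B) (E - D) * d3 = det2 B D * t3"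
    using nz by (simp add: field_simps)
qed

lemma step_constant:
  fixes q :: "int \<Rightarrow> 'a"
  assumes "\<And>j. q (j + 1) = q j"
  shows "q j = q 0"
proof (induction j rule: int_induct[where k=0])
  case (step2 i)
  then show ?case using assms[of "i - 1"] by simp
qed (use assms in auto)

context convex_cycle
begin

text \<open>With \<open>S j = d j + d (j + 1)\<close>, so that \<open>f j = S j - T j\<close>, the identities say that \<open>r = T j / S j\<close> is the
  same for \<open>j - 1\<close> and \<open>j\<close>. Inserting this into the Pluecker relation leaves
  \<open>r * (d (j - 1) * d (j + 1) - (d j)\<^sup>2) = 0\<close>.\<close>

theorem regular_if_covector_zero:
  assumes p: "\<And>j. variation_covector v j = 0"
  shows "\<exists>A :: real^2^2. 0 < det A \<and> v = (\<lambda>i. A *v regular_cycle m i)"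
proof -
  define d where "d j = det2 (v (j - 1)) (v j)" for j
  define T where "T j = triangle_det (v (j - 1)) (v j) (v (j + 1))" for j
  define f where "f j = det2 (v (j - 1)) (v (j + 1))" for j
  define g where "g j = det2 (v (j - 1) - v (j - 2)) (v (j + 1) - v j)" for j
  have pos: "0 < d j" "0 < T j" for j using det_pos corner_pos by (simp_all add: d_def T_def)
  have f_eq: "f j = d j + d (j + 1) - T j" for j
    using det2_swap[of "v (j - 1)" "v (j + 1)"] by (simp add: f_def d_def T_def triangle_det_def)
  have gf: "g j * d j = f j * T (j - 1)" "g (j + 1) * d (j + 1) = f j * T (j + 1)" for j
  proof -
    have idx: "j - 1 - 1 = j - 2" "j - 1 + 1 = j" "j + 1 - 1 = j" "j + 1 + 1 = j + 2" "j + 1 - 2 = j - 1"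
      by simp_all
    have nz: "T (j - 1) \<noteq> 0" "T j \<noteq> 0" "T (j + 1) \<noteq> 0" "d j \<noteq> 0" "d (j + 1) \<noteq> 0"
      using pos less_irrefl by metis+
    note five_point_identities[OF refl refl refl refl refl nz[unfolded T_def d_def idx] p[of j, unfolded variation_covector_def]]
    then show "g j * d j = f j * T (j - 1)" "g (j + 1) * d (j + 1) = f j * T (j + 1)"
      unfolding g_def d_def f_def T_def idx by blast+
  qed
  have plucker: "g j * d j = d j * (f j + f (j - 1)) - d j * d j + d (j - 1) * d (j + 1) - f (j - 1) * f j" for j
  proof -
    have idx: "j - 1 - 1 = j - 2" "j - 1 + 1 = j" "j + 1 - 1 = j" by simp_all
    show ?thesis unfolding g_def d_def f_def idx by (simp add: det2_def algebra_simps)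
  qed
  have local: "(d j + d (j + 1)) * T (j - 1) = (d (j - 1) + d j) * T j \<and> d (j - 1) * d (j + 1) = d j * d j" for j
  proof -
    have fT: "f j * T (j - 1) = f (j - 1) * T j" using gf(1)[of j] gf(2)[of "j - 1"] by simp
    have cross: "(d j + d (j + 1)) * T (j - 1) = (d (j - 1) + d j) * T j"
      using fT f_eq[of j] f_eq[of "j - 1"] by (simp add: algebra_simps)
    define r where "r = T j / (d j + d (j + 1))"
    have S: "0 < d j + d (j + 1)" "0 < d (j - 1) + d j" using pos by (simp_all add: add_pos_pos)
    have r: "0 < r" using S pos by (simp add: r_def)
    have Tj: "T j = r * (d j + d (j + 1))" using S by (simp add: r_def)
    have "(d j + d (j + 1)) * T (j - 1) = (d j + d (j + 1)) * (r * (d (j - 1) + d j))"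
      using cross by (simp add: Tj algebra_simps)
    then have Tj1: "T (j - 1) = r * (d (j - 1) + d j)" using S(1) by (metis less_irrefl mult_cancel_left)
    have fj: "f j = (1 - r) * (d j + d (j + 1))" "f (j - 1) = (1 - r) * (d (j - 1) + d j)"
      using f_eq[of j] f_eq[of "j - 1"] by (simp_all add: Tj Tj1 algebra_simps)
    have "r * (d (j - 1) * d (j + 1) - d j * d j) = 0"
      using gf(1)[of j] unfolding plucker fj Tj1 by (simp add: algebra_simps)
    then show ?thesis using cross r by simp
  qed
  \<comment> \<open>So \<open>d\<close> is a geometric progression; being periodic it is constant.\<close>
  define q where "q j = d (j + 1) / d j" for j
  have "q (j + 1) = q j" for j
    using local[of "j + 1"] pos[of j] pos[of "j + 1"] by (simp add: q_def field_simps)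
  then have q: "q j = q 0" for j by (rule step_constant)
  have geo: "d (int n) = q 0 ^ n * d 0" for n
  proof (induction n)
    case (Suc n)
    have "d (int n + 1) = q 0 * d (int n)" using q[of "int n"] pos[of "int n"] by (simp add: q_def field_simps)
    then show ?case using Suc by (simp add: add.commute)
  qed simp
  have "q 0 ^ m = 1"
  proof -
    have "d (int m) = d 0" using periodic[of 0] periodic[of "-1"] by (simp add: d_def)
    then show ?thesis using geo[of m] pos[of 0] by simp
  qed
  moreover have "0 < q 0" using pos by (simp add: q_def)
  ultimately have q1: "q 0 = 1"
    using power_eq_imp_eq_base[of "q 0" m 1] m_pos by simp
  have "d (j + 1) = d j" for j using q[of j] q1 pos[of j] by (simp add: q_def field_simps)
  then have d_const: "d j = d 0" for j by (rule step_constant)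
  have "T (j + 1) = T j" for j
  proof -
    have "(d 0 + d 0) * T j = (d 0 + d 0) * T (j + 1)"
      using local[of "j + 1"] unfolding d_const[of "j + 1"] d_const[of "j + 1 + 1"] d_const[of "j + 1 - 1"] by simp
    then show ?thesis using pos(1)[of 0] by simp
  qed
  then have T_const: "T j = T 0" for j by (rule step_constant)
  show ?thesis
  proof (rule regular_if_constant)
    show "det2 (v (i - 1)) (v i) = d 0" for i using d_const[of i] by (simp add: d_def)
    show "det2 (v (i - 1)) (v (i + 1)) = 2 * d 0 - T 0" for i
      using f_eq[of i] d_const[of i] d_const[of "i + 1"] T_const[of i] by (simp add: f_def)
  qed
qed

section \<open>Translations of the polygon\<close>

abbreviation "log_slack x \<equiv> \<Sum>j\<in>{0..<int m}. ln (1 - e j \<bullet> x)"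

text \<open>Translation leaves the triangles unchanged and multiplies \<open>d j\<close> by the slack of \<open>x\<close> at the edge \<open>j\<close>.\<close>

lemma c1_at_eq:
  assumes "x \<in> interior polygon"
  shows "c1_at polygon x = cycle_functional m v - log_slack x"
proof -
  have slack: "0 < 1 - e i \<bullet> x" for i using assms unfolding interior_polygon by auto
  define w where "w i = v i - x" for i
  have det: "det2 (w (i - 1)) (w i) = det2 (v (i - 1)) (v i) * (1 - e i \<bullet> x)" for i
    unfolding slack_eq by (simp add: w_def triangle_det_def det2_def algebra_simps)
  have tri: "triangle_det (w i) (w j) (w k) = triangle_det (v i) (v j) (v k)" for i j k
    by (simp add: w_def triangle_det_def det2_def algebra_simps)
  interpret w: convex_cycle m w
  proof
    show "w (i + int m) = w i" for i by (simp add: w_def)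
    show "0 < det2 (w (i - 1)) (w i)" for i unfolding det using det_pos slack by simp
  qed (use three_le left_of_edge tri in auto)
  have "range w = (+) (- x) ` range v" by (auto simp: w_def image_iff)
  then have "convex hull (range w) = (\<lambda>y. y - x) ` polygon"
    by (simp only: convex_hull_translation) (simp add: image_def)
  then have "c1_at polygon x = cycle_functional m w" unfolding c1_at_def using w.c1_eq by simp
  also have "\<dots> = (\<Sum>j\<in>{0..<int m}. (ln (triangle_det (v (j - 1)) (v j) (v (j + 1)))
      - ln (det2 (v (j - 1)) (v j))) - ln (1 - e j \<bullet> x))"
    unfolding cycle_functional_def tri det
    by (intro sum.cong refl) (use det_pos slack in \<open>simp add: ln_mult_pos\<close>)
  finally show ?thesis by (simp add: cycle_functional_def sum_subtractf)
qed

text \<open>Strict concavity in the form \<open>ln (1 - s) \<le> - s\<close>, with equality only for \<open>s = 0\<close>; the numbers \<open>s j\<close> have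
  sum zero by the assumption on \<open>x0\<close>.\<close>

lemma log_slack_less:
  assumes x0: "x0 \<in> interior polygon" "(\<Sum>j\<in>{0..<int m}. e j /\<^sub>R (1 - e j \<bullet> x0)) = 0"
    and x: "x \<in> interior polygon" "x \<noteq> x0"
  shows "log_slack x < log_slack x0"
proof -
  have slack: "0 < 1 - e j \<bullet> x0" "0 < 1 - e j \<bullet> x" for j using x0 x unfolding interior_polygon by auto
  define s where "s j = (e j /\<^sub>R (1 - e j \<bullet> x0)) \<bullet> (x - x0)" for j
  have ratio: "(1 - e j \<bullet> x) / (1 - e j \<bullet> x0) = 1 - s j" for j
  proof -
    have "(1 - a) / (1 - b) = 1 - (a - b) / (1 - b)" if "0 < 1 - b" for a b :: real
      using that by (simp add: field_simps)
    from this[OF slack(1)[of j], of "e j \<bullet> x"] show ?thesis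
      by (simp add: s_def inner_diff_right divide_inverse algebra_simps)
  qed
  have pos: "0 < 1 - s j" for j unfolding ratio[symmetric] using slack by simp
  have ln: "ln (1 - e j \<bullet> x) - ln (1 - e j \<bullet> x0) = ln (1 - s j)" for j
    unfolding ratio[symmetric] using slack(1)[of j] slack(2)[of j] by (simp add: ln_div)
  have "s 0 \<noteq> 0 \<or> s 1 \<noteq> 0"
  proof (rule ccontr)
    assume "\<not> ?thesis"
    then have "(x - x0) \<bullet> e 0 = 0" "(x - x0) \<bullet> e 1 = 0"
      using slack(1)[of 0] slack(1)[of 1] by (simp_all add: s_def inner_commute)
    then show False
      using inner_eq_zero_imp[of "x - x0" "e 0" "e 1"] dual_det_pos[of 0] x(2) by simp
  qed
  moreover have "0 \<in> {0..<int m}" "1 \<in> {0..<int m}" using three_le by auto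
  ultimately obtain k where k: "k \<in> {0..<int m}" "s k \<noteq> 0" by blast
  have "(\<Sum>j\<in>{0..<int m}. ln (1 - s j)) < (\<Sum>j\<in>{0..<int m}. - s j)"
  proof (rule sum_strict_mono_ex1)
    show "\<forall>j\<in>{0..<int m}. ln (1 - s j) \<le> - s j" using ln_le_minus_one[OF pos] by force
    have "ln (1 - s k) \<noteq> - s k" using ln_eq_minus_one[OF pos, of k] k by auto
    then show "\<exists>j\<in>{0..<int m}. ln (1 - s j) < - s j"
      using k ln_le_minus_one[OF pos, of k] by (intro bexI[of _ k]) auto
  qed simp
  also have "\<dots> = - ((\<Sum>j\<in>{0..<int m}. e j /\<^sub>R (1 - e j \<bullet> x0)) \<bullet> (x - x0))"
    by (simp add: s_def inner_sum_left sum_negf)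
  finally have "(\<Sum>j\<in>{0..<int m}. ln (1 - s j)) < 0" by (simp add: x0(2))
  then show ?thesis unfolding ln[symmetric] by (simp add: sum_subtractf)
qed

text \<open>Slacks are bounded above on the polygon. So where the sum of logarithms is at least its value \<open>0\<close>
  at the origin, every slack is at least some \<open>\<delta> > 0\<close>, and it suffices to maximize over a compact
  set.\<close>

lemma log_slack_maximum:
  "\<exists>x0\<in>interior polygon. \<forall>x\<in>interior polygon. log_slack x \<le> log_slack x0"
proof -
  have comp: "compact polygon" using finite_range by (rule compact_convex_hull[OF finite_imp_compact])
  obtain B where B: "\<And>x. x \<in> polygon \<Longrightarrow> norm x \<le> B" "0 < B"
    using compact_imp_bounded[OF comp] bounded_pos by blast
  define M where "M = 1 + (\<Sum>j\<in>{0..<int m}. norm (e j)) * B"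
  have M: "1 \<le> M" using B(2) by (simp add: M_def sum_nonneg)
  have upper: "1 - e j \<bullet> x \<le> M" if "x \<in> polygon" "j \<in> {0..<int m}" for x j
  proof -
    have "- (e j \<bullet> x) \<le> norm (e j) * norm x" using norm_cauchy_schwarz[of "- e j" x] by simp
    also have "\<dots> \<le> (\<Sum>j\<in>{0..<int m}. norm (e j)) * B"
      using B that by (intro mult_mono member_le_sum sum_nonneg) auto
    finally show ?thesis by (simp add: M_def)
  qed
  define \<delta> where "\<delta> = exp (- (m * ln M))"
  have \<delta>: "0 < \<delta>" "\<delta> \<le> 1" using M by (simp_all add: \<delta>_def)
  have lower: "\<delta> \<le> 1 - e k \<bullet> x" if x: "x \<in> interior polygon" "0 \<le> log_slack x" and k: "k \<in> {0..<int m}" for x k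
  proof -
    have slack: "0 < 1 - e j \<bullet> x" for j using x(1) unfolding interior_polygon by auto
    have xp: "x \<in> polygon" using x(1) interior_subset by blast
    have "log_slack x = ln (1 - e k \<bullet> x) + (\<Sum>j\<in>{0..<int m} - {k}. ln (1 - e j \<bullet> x))"
      using k by (simp add: sum.remove)
    also have "(\<Sum>j\<in>{0..<int m} - {k}. ln (1 - e j \<bullet> x)) \<le> (\<Sum>j\<in>{0..<int m} - {k}. ln M)"
      using slack upper[OF xp] M by (intro sum_mono) (auto intro!: ln_mono)
    also have "\<dots> \<le> (\<Sum>j\<in>{0..<int m}. ln M)" using M by (intro sum_mono2) auto
    finally have "- (m * ln M) \<le> ln (1 - e k \<bullet> x)" using x(2) by simp
    then show ?thesis unfolding \<delta>_def using slack[of k] by (simp add: ln_ge_iff)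
  qed
  define K where "K = {x. \<forall>j\<in>{0..<int m}. e j \<bullet> x \<le> 1 - \<delta>}"
  have K_slack: "\<delta> \<le> 1 - e j \<bullet> x" if "x \<in> K" for x j
  proof -
    obtain j' where "e j' = e j" "0 \<le> j'" "j' < 0 + int m"
      by (rule periodic_window[of e m j 0]) (use dual_periodic m_pos in auto)
    then have "j' \<in> {0..<int m}" "e j' = e j" by auto
    then show ?thesis using that unfolding K_def by fastforce
  qed
  have K_int: "K \<subseteq> interior polygon"
  proof
    fix x assume "x \<in> K"
    then have "e j \<bullet> x < 1" for j using K_slack[of x j] \<delta>(1) by linarith
    then show "x \<in> interior polygon" by (simp add: interior_polygon)
  qed
  have "K = (\<Inter>j\<in>{0..<int m}. {x. e j \<bullet> x \<le> 1 - \<delta>})" by (auto simp: K_def)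
  then have "closed K" by (auto intro: closed_halfspace_le)
  then have "compact K"
    using comp K_int interior_subset by (metis compact_Int_closed inf.absorb_iff2 order_trans)
  moreover have zero: "0 \<in> K" using \<delta> by (simp add: K_def)
  moreover have "continuous_on K log_slack"
  proof -
    have "1 - e j \<bullet> x \<noteq> 0" if "x \<in> K" for j x using K_slack[OF that, of j] \<delta>(1) by linarith
    then show ?thesis by (intro continuous_intros) auto
  qed
  ultimately obtain x0 where x0: "x0 \<in> K" "\<And>x. x \<in> K \<Longrightarrow> log_slack x \<le> log_slack x0"
    using continuous_attains_sup[of K log_slack] by blast
  have "log_slack x \<le> log_slack x0" if "x \<in> interior polygon" for x
  proof (cases "0 \<le> log_slack x")
    case True
    then have "x \<in> K" using lower[OF that] by (force simp: K_def)
    then show ?thesis by (rule x0(2))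
  next
    case False
    moreover have "0 \<le> log_slack x0" using x0(2)[OF zero] by simp
    ultimately show ?thesis by simp
  qed
  then show ?thesis using x0(1) K_int by blast
qed

lemma log_slack_critical:
  assumes x0: "x0 \<in> interior polygon" and max: "\<forall>x\<in>interior polygon. log_slack x \<le> log_slack x0"
  shows "(\<Sum>j\<in>{0..<int m}. e j /\<^sub>R (1 - e j \<bullet> x0)) = 0"
proof -
  define w where "w = (\<Sum>j\<in>{0..<int m}. e j /\<^sub>R (1 - e j \<bullet> x0))"
  have slack: "0 < 1 - e j \<bullet> x0" for j using x0 unfolding interior_polygon by auto
  have "((\<lambda>t. log_slack (x0 + t *\<^sub>R w)) has_real_derivative
      (\<Sum>j\<in>{0..<int m}. - (e j \<bullet> w) / (1 - e j \<bullet> x0))) (at 0)"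
  proof (rule DERIV_sum)
    fix j
    have "((\<lambda>t. 1 - e j \<bullet> (x0 + t *\<^sub>R w)) has_real_derivative - (e j \<bullet> w)) (at 0)"
      unfolding inner_add_right inner_scaleR_right by (rule derivative_eq_intros refl | simp)+
    from DERIV_ln_divide[THEN DERIV_chain2, OF _ this]
    show "((\<lambda>t. ln (1 - e j \<bullet> (x0 + t *\<^sub>R w))) has_real_derivative - (e j \<bullet> w) / (1 - e j \<bullet> x0)) (at 0)"
      using slack[of j] by simp
  qed
  moreover have "(\<Sum>j\<in>{0..<int m}. - (e j \<bullet> w) / (1 - e j \<bullet> x0)) = - (w \<bullet> w)"
  proof -
    have "w \<bullet> w = (\<Sum>j\<in>{0..<int m}. (e j /\<^sub>R (1 - e j \<bullet> x0)) \<bullet> w)"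
      by (subst (1) w_def) (simp add: inner_sum_left)
    then show ?thesis by (simp add: sum_negf divide_inverse mult.commute)
  qed
  ultimately have deriv: "((\<lambda>t. log_slack (x0 + t *\<^sub>R w)) has_real_derivative - (w \<bullet> w)) (at 0)" by simp
  obtain \<epsilon> where \<epsilon>: "0 < \<epsilon>" "ball x0 \<epsilon> \<subseteq> interior polygon"
    using x0 open_contains_ball open_interior by metis
  have "- (w \<bullet> w) = 0"
  proof (rule DERIV_local_max[OF deriv])
    show "0 < \<epsilon> / (norm w + 1)" using \<epsilon> by (simp add: add_nonneg_pos)
    show "\<forall>y. \<bar>0 - y\<bar> < \<epsilon> / (norm w + 1) \<longrightarrow> log_slack (x0 + y *\<^sub>R w) \<le> log_slack (x0 + 0 *\<^sub>R w)"
    proof (intro allI impI)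
      fix y assume "\<bar>0 - y\<bar> < \<epsilon> / (norm w + 1)"
      then have "\<bar>y\<bar> * (norm w + 1) < \<epsilon>" by (simp add: pos_less_divide_eq add_nonneg_pos)
      moreover have "\<bar>y\<bar> * norm w \<le> \<bar>y\<bar> * (norm w + 1)" by (intro mult_left_mono) auto
      ultimately have "x0 + y *\<^sub>R w \<in> ball x0 \<epsilon>" by (simp add: dist_norm)
      then show "log_slack (x0 + y *\<^sub>R w) \<le> log_slack (x0 + 0 *\<^sub>R w)" using \<epsilon>(2) max by auto
    qed
  qed
  then show ?thesis by (simp add: w_def)
qed

lemma s_inf_eq:
  assumes x0: "x0 \<in> interior polygon" "(\<Sum>j\<in>{0..<int m}. e j /\<^sub>R (1 - e j \<bullet> x0)) = 0"
  shows "s_inf polygon = x0"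
  unfolding s_inf_def
proof (rule the_equality)
  show "is_arg_min (c1_at polygon) (\<lambda>x. x \<in> interior polygon) x0"
    using log_slack_less[OF x0] x0(1) unfolding is_arg_min_def
    by (auto simp: c1_at_eq) (metis less_asym less_irrefl)
  show "x = x0" if "is_arg_min (c1_at polygon) (\<lambda>x. x \<in> interior polygon) x" for x
    using log_slack_less[OF x0, of x] x0(1) that unfolding is_arg_min_def by (force simp: c1_at_eq)
qed

lemma s_inf_eq_0_iff: "s_inf polygon = 0 \<longleftrightarrow> (\<Sum>j\<in>{0..<int m}. e j) = 0"
proof
  assume s0: "s_inf polygon = 0"
  obtain x0 where x0: "x0 \<in> interior polygon" "\<forall>x\<in>interior polygon. log_slack x \<le> log_slack x0"
    using log_slack_maximum by blast
  note crit = log_slack_critical[OF x0]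
  have "x0 = 0" using s_inf_eq[OF x0(1) crit] s0 by simp
  then show "(\<Sum>j\<in>{0..<int m}. e j) = 0" using crit by simp
next
  assume "(\<Sum>j\<in>{0..<int m}. e j) = 0"
  then show "s_inf polygon = 0" by (intro s_inf_eq) (simp_all add: interior_polygon)
qed

end

section \<open>Existence of a maximum\<close>

definition centred :: "nat \<Rightarrow> (int \<Rightarrow> real^2) \<Rightarrow> bool" where
  "centred m u \<longleftrightarrow> (\<Sum>j\<in>{0..<int m}. u j) = 0"

definition isotropic :: "nat \<Rightarrow> (int \<Rightarrow> real^2) \<Rightarrow> bool" where
  "isotropic m u \<longleftrightarrow> (\<forall>n. (\<Sum>j\<in>{0..<int m}. (n \<bullet> u j)\<^sup>2) = n \<bullet> n)"

lemma centred_matrix_image: "centred m u \<Longrightarrow> centred m (\<lambda>i. A *v u i)"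
  using linear_sum[OF matrix_vector_mul_linear[of A], of u "{0..<int m}"] by (simp add: centred_def)

context convex_cycle
begin

text \<open>Gram-Schmidt for the two coordinate rows \<open>x\<close> and \<open>y\<close> of the cycle, regarded as vectors with \<open>m\<close>
  entries. They are linearly independent since \<open>det2 (v 0) (v 1) \<noteq> 0\<close>.\<close>

lemma exists_isotropic_image: "\<exists>A :: real^2^2. 0 < det A \<and> isotropic m (\<lambda>i. A *v v i)"
proof -
  let ?I = "{0..<int m}"
  have I: "0 \<in> ?I" "1 \<in> ?I" using three_le by auto
  define x y where "x j = v j $ 1" and "y j = v j $ 2" for j
  have d01: "x 0 * y 1 - y 0 * x 1 \<noteq> 0" using det_pos[of 1] by (simp add: det2_def x_def y_def)
  define a b c where "a = (\<Sum>j\<in>?I. (x j)\<^sup>2)" and "b = (\<Sum>j\<in>?I. x j * y j)" and "c = (\<Sum>j\<in>?I. (y j)\<^sup>2)"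
  have a: "0 < a"
  proof -
    have "x 0 \<noteq> 0 \<or> x 1 \<noteq> 0" using d01 by auto
    then obtain k where "k \<in> ?I" "x k \<noteq> 0" using I by blast
    then show ?thesis unfolding a_def by (intro sum_pos2[of _ k]) auto
  qed
  define r where "r = b / a"
  have schur: "(\<Sum>j\<in>?I. (y j - r * x j)\<^sup>2) = c - b * r"
  proof -
    have "(\<Sum>j\<in>?I. (y j - r * x j)\<^sup>2) = c - 2 * r * b + r\<^sup>2 * a"
      by (simp add: a_def b_def c_def power2_diff power_mult_distrib sum.distrib sum_subtractf
          sum_distrib_left algebra_simps)
    then show ?thesis using a by (simp add: r_def power2_eq_square)
  qed
  have k: "0 < c - b * r"
  proof -
    have "y 0 - r * x 0 \<noteq> 0 \<or> y 1 - r * x 1 \<noteq> 0" using d01 by (auto simp: algebra_simps)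
    then obtain k where "k \<in> ?I" "y k - r * x k \<noteq> 0" using I by blast
    then show ?thesis unfolding schur[symmetric] by (intro sum_pos2[of _ k]) auto
  qed
  define p q where "p = 1 / sqrt a" and "q = 1 / sqrt (c - b * r)"
  have pq: "0 < p" "0 < q" "p\<^sup>2 * a = 1" "q\<^sup>2 * (c - b * r) = 1"
    using a k by (simp_all add: p_def q_def power_divide)
  define A :: "real^2^2" where "A = vector [vector [p, 0], vector [- q * r, q]]"
  have A: "(A *v v j) $ 1 = p * x j" "(A *v v j) $ 2 = q * (y j - r * x j)" for j
    by (simp_all add: A_def matrix_vector_mult_def sum_2 x_def y_def algebra_simps)
  have "det A = p * q" by (simp add: A_def det_2)
  then have "0 < det A" using pq by simp
  moreover have "(\<Sum>j\<in>?I. (n \<bullet> (A *v v j))\<^sup>2) = n \<bullet> n" for n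
  proof -
    have "(\<Sum>j\<in>?I. (n \<bullet> (A *v v j))\<^sup>2) = (\<Sum>j\<in>?I. (n $ 1)\<^sup>2 * (p\<^sup>2 * (x j)\<^sup>2)
        + 2 * n $ 1 * n $ 2 * p * q * (x j * y j - r * (x j)\<^sup>2) + (n $ 2)\<^sup>2 * (q\<^sup>2 * (y j - r * x j)\<^sup>2))"
      unfolding inner_real2[of n] A by (intro sum.cong refl) (simp add: power2_eq_square algebra_simps)
    also have "\<dots> = (n $ 1)\<^sup>2 * (p\<^sup>2 * a) + 2 * n $ 1 * n $ 2 * p * q * (b - r * a) + (n $ 2)\<^sup>2 * (q\<^sup>2 * (c - b * r))"
      unfolding schur[symmetric] unfolding a_def b_def
      by (simp only: sum.distrib sum_distrib_left[symmetric] sum_subtractf)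
    also have "\<dots> = n \<bullet> n" using pq a by (simp add: inner_real2 r_def power2_eq_square)
    finally show ?thesis .
  qed
  ultimately show ?thesis unfolding isotropic_def by blast
qed

lemma isotropic_norm_le:
  assumes "isotropic m v"
  shows "norm (v j) \<le> 1"
proof -
  obtain k where k: "v k = v j" "0 \<le> k" "k < 0 + int m"
    by (rule periodic_window[of v m j 0]) (use m_pos in auto)
  have "(v k \<bullet> v k)\<^sup>2 \<le> (\<Sum>i\<in>{0..<int m}. (v k \<bullet> v i)\<^sup>2)"
    using k by (intro member_le_sum[where f="\<lambda>i. (v k \<bullet> v i)\<^sup>2"]) auto
  also have "\<dots> = v k \<bullet> v k" using assms by (simp add: isotropic_def)
  finally have "v k \<bullet> v k \<le> 1"
    using mult_le_cancel_left_pos[of "v k \<bullet> v k" "v k \<bullet> v k" 1]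
    by (cases "v k = 0") (auto simp: power2_eq_square)
  then show ?thesis using k(1) by (simp add: norm_le_square)
qed

text \<open>The distance from the origin to the line of the edge \<open>i\<close> is \<open>1 / norm (e i)\<close>, so this keeps the edges
  away from the origin. The values \<open>t\<close> of \<open>e i\<close> at the vertices lie between \<open>- norm (e i)\<close> and \<open>1\<close>, have sum \<open>0\<close> and
  sum of squares \<open>(norm (e i))\<^sup>2\<close>; summing \<open>(t + norm (e i)) * (1 - t) \<ge> 0\<close> gives the bound.\<close>

lemma isotropic_dual_norm_le:
  assumes "isotropic m v" "centred m v"
  shows "norm (e i) \<le> m"
proof -
  define E where "E = norm (e i)"
  have E: "0 < E" unfolding E_def using dual_inner(1)[of i] by (metis inner_zero_left zero_less_norm_iff zero_neq_one)
  have "0 \<le> (\<Sum>j\<in>{0..<int m}. (e i \<bullet> v j + E) * (1 - e i \<bullet> v j))"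
  proof (intro sum_nonneg mult_nonneg_nonneg)
    fix j
    have "- (e i \<bullet> v j) \<le> E * norm (v j)" using norm_cauchy_schwarz[of "- e i" "v j"] by (simp add: E_def)
    also have "\<dots> \<le> E * 1" using isotropic_norm_le[OF assms(1)] E by (intro mult_left_mono) auto
    finally show "0 \<le> e i \<bullet> v j + E" by simp
    show "0 \<le> 1 - e i \<bullet> v j" using dual_inner_le[of i j] by simp
  qed
  also have "\<dots> = (1 - E) * (e i \<bullet> (\<Sum>j\<in>{0..<int m}. v j)) - (\<Sum>j\<in>{0..<int m}. (e i \<bullet> v j)\<^sup>2) + m * E"
    by (simp add: inner_sum_right sum_distrib_left sum.distrib sum_subtractf power2_eq_square algebra_simps)
  also have "\<dots> = E * (m - E)"
    using assms by (simp add: centred_def isotropic_def E_def dot_square_norm power2_eq_square algebra_simps)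
  finally show ?thesis using E by (simp add: zero_le_mult_iff E_def)
qed

lemma edge_length: "norm (v i - v (i - 1)) = norm (e i) * det2 (v (i - 1)) (v i)"
proof -
  have "norm (quarter_turn a) = norm a" for a :: "real^2"
    by (simp add: norm_eq_sqrt_inner inner_real2 add.commute)
  then show ?thesis using det_pos[of i] by (simp add: dual_vertex_def norm_minus_commute)
qed

text \<open>The functional is the sum of the logarithms of \<open>\<rho> j = T j / d j\<close>, and each \<open>\<rho> j\<close> is at most \<open>m + 1\<close>; so a
  lower bound for the sum gives one for every \<open>\<rho> j\<close>. Moreover \<open>\<rho> (i - 1)\<close> is the change of \<open>e (i - 1)\<close>
  along the edge \<open>i\<close>, hence at most \<open>m\<close> times the length of that edge, which is
  \<open>norm (e i) * d i\<close>.\<close>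

lemma lower_bounds:
  assumes iso: "isotropic m v" "centred m v" and F: "F0 \<le> cycle_functional m v"
  defines "\<epsilon> \<equiv> exp (F0 - m * ln (m + 1))"
  shows "\<epsilon> / m\<^sup>2 \<le> det2 (v (i - 1)) (v i)"
    and "\<epsilon> * (\<epsilon> / m\<^sup>2) \<le> triangle_det (v (i - 1)) (v i) (v (i + 1))"
proof -
  have mR: "0 < real m" using m_pos by simp
  define \<rho> where "\<rho> j = 1 - e j \<bullet> v (j + 1)" for j
  have \<rho>_eq: "\<rho> j = triangle_det (v (j - 1)) (v j) (v (j + 1)) / det2 (v (j - 1)) (v j)" for j
    unfolding \<rho>_def by (rule slack_eq_divide)
  have \<rho>_pos: "0 < \<rho> j" for j unfolding \<rho>_eq using corner_pos det_pos by simp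
  have \<rho>_le: "\<rho> j \<le> m + 1" for j
  proof -
    have "- (e j \<bullet> v (j + 1)) \<le> norm (e j) * norm (v (j + 1))" using norm_cauchy_schwarz[of "- e j"] by simp
    also have "\<dots> \<le> real m * 1"
      using isotropic_dual_norm_le[OF iso] isotropic_norm_le[OF iso(1)] by (intro mult_mono) auto
    finally show ?thesis by (simp add: \<rho>_def)
  qed
  have F_eq: "cycle_functional m v = (\<Sum>j\<in>{0..<int m}. ln (\<rho> j))"
    unfolding cycle_functional_def \<rho>_eq
  proof (rule sum.cong)
    fix j
    show "ln (triangle_det (v (j - 1)) (v j) (v (j + 1))) - ln (det2 (v (j - 1)) (v j))
      = ln (triangle_det (v (j - 1)) (v j) (v (j + 1)) / det2 (v (j - 1)) (v j))"
      using corner_pos[of j] det_pos[of j] by (simp add: ln_div)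
  qed simp
  have \<rho>_ge: "\<epsilon> \<le> \<rho> j" for j
  proof -
    obtain k where "(\<rho> k) = \<rho> j" "0 \<le> k" "k < 0 + int m"
      by (rule periodic_window[of \<rho> m j 0]) (use m_pos in \<open>auto simp: \<rho>_def dual_periodic\<close>)
    then have k: "k \<in> {0..<int m}" "\<rho> k = \<rho> j" by auto
    have "F0 \<le> ln (\<rho> k) + (\<Sum>j\<in>{0..<int m} - {k}. ln (\<rho> j))"
      using F k(1) unfolding F_eq by (simp add: sum.remove)
    also have "(\<Sum>j\<in>{0..<int m} - {k}. ln (\<rho> j)) \<le> (\<Sum>j\<in>{0..<int m} - {k}. ln (m + 1))"
      using \<rho>_pos \<rho>_le by (intro sum_mono) (auto intro!: ln_mono)
    also have "\<dots> \<le> (\<Sum>j\<in>{0..<int m}. ln (m + 1))" by (intro sum_mono2) auto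
    finally have "F0 - m * ln (m + 1) \<le> ln (\<rho> k)" by simp
    then show ?thesis unfolding \<epsilon>_def using \<rho>_pos[of j] k(2) by (simp add: ln_ge_iff)
  qed
  have d: "\<epsilon> / m\<^sup>2 \<le> det2 (v (i - 1)) (v i)" for i
  proof -
    have "\<epsilon> \<le> e (i - 1) \<bullet> (v (i - 1) - v i)" using \<rho>_ge[of "i - 1"] by (simp add: \<rho>_def inner_diff_right)
    also have "\<dots> \<le> norm (e (i - 1)) * norm (v i - v (i - 1))"
      using norm_cauchy_schwarz by (metis norm_minus_commute)
    also have "\<dots> \<le> real m * (real m * det2 (v (i - 1)) (v i))"
      unfolding edge_length using isotropic_dual_norm_le[OF iso] det_pos[of i]
      by (intro mult_mono mult_nonneg_nonneg) auto
    finally show ?thesis using mR by (simp add: field_simps power2_eq_square)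
  qed
  then show "\<epsilon> / m\<^sup>2 \<le> det2 (v (i - 1)) (v i)" .
  have "\<epsilon> * (\<epsilon> / m\<^sup>2) \<le> \<rho> i * det2 (v (i - 1)) (v i)"
    using \<rho>_ge d \<rho>_pos[of i] by (intro mult_mono) (auto simp: \<epsilon>_def)
  then show "\<epsilon> * (\<epsilon> / m\<^sup>2) \<le> triangle_det (v (i - 1)) (v i) (v (i + 1))"
    using det_pos[of i] by (simp add: \<rho>_eq)
qed

text \<open>The height over an edge is smallest at a vertex adjacent to the edge: at any other vertex a
  local minimum of the height would be a minimum over the whole polygon, which lies in the cone
  spanned at that vertex by its two edges.\<close>

lemma triangle_ge_corner:
  assumes corner: "\<And>i. \<delta> \<le> triangle_det (v (i - 1)) (v i) (v (i + 1))"
    and k: "i < k" "k < i + int m - 1"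
  shows "\<delta> \<le> triangle_det (v (i - 1)) (v i) (v k)"
proof -
  define H where "H x = triangle_det (v (i - 1)) (v i) x" for x
  define J where "J = {i<..<i + int m - 1}"
  have "finite J" "J \<noteq> {}" using k by (auto simp: J_def)
  from ex_min_if_finite[of "(\<lambda>k. H (v k)) ` J"] this
  obtain l where l: "l \<in> J" "\<And>j. j \<in> J \<Longrightarrow> H (v l) \<le> H (v j)" by (auto simp: not_less)
  have "\<delta> \<le> H (v l)"
  proof -
    consider "l = i + 1" | "l = i - 2 + int m" | "i + 1 < l" "l < i + int m - 2"
      using l(1) unfolding J_def by fastforce
    then show ?thesis
    proof cases
      case 1
      then show ?thesis using corner[of i] by (simp add: H_def)
    next
      case 2
      then have "v l = v (i - 2)" by (simp only: periodic)
      then show ?thesis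
        using corner[of "i - 1"] triangle_det_rotate[of "v (i - 1)" "v i" "v (i - 2)"] by (simp add: H_def)
    next
      case 3
      let ?A = "v (l - 1)" and ?B = "v l" and ?C = "v (l + 1)"
      have ident: "triangle_det ?A ?B ?C * (H x - H ?B)
        = triangle_det ?B ?C x * (H ?A - H ?B) + triangle_det ?A ?B x * (H ?C - H ?B)" for x
        unfolding H_def triangle_det_def det2_def by (simp add: algebra_simps)
      have "0 < triangle_det ?A ?B (v (i + int m))" using 3 by (intro left_of_edge) auto
      moreover have "0 < triangle_det ?B ?C (v (i + int m))"
        using left_of_edge[of "l + 1" "i + int m"] 3 by simp
      moreover have "H ?B \<le> H ?A" "H ?B \<le> H ?C" using l(2) 3 by (auto simp: J_def)
      ultimately have "0 \<le> triangle_det ?A ?B ?C * (H (v i) - H ?B)"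
        unfolding ident by simp
      then have "H ?B \<le> H (v i)" using corner_pos[of l] by (simp add: zero_le_mult_iff)
      moreover have "H (v i) = 0"
        unfolding H_def triangle_det_def using det2_swap[of "v i" "v (i - 1)"] by simp
      moreover have "0 < H ?B" unfolding H_def using l(1) by (intro left_of_edge) (auto simp: J_def)
      ultimately show ?thesis by simp
    qed
  qed
  also have "H (v l) \<le> H (v k)" using k by (intro l(2)) (simp add: J_def)
  finally show ?thesis by (simp add: H_def)
qed

end

lemma cyclic_enumeration:
  assumes "CARD('n::finite) = m" "0 < m"
  obtains s :: "int \<Rightarrow> 'n::finite" where "\<And>i. s (i + int m) = s i" "bij_betw s {0..<int m} UNIV"
proof -
  obtain h :: "int \<Rightarrow> 'n" where h: "bij_betw h {0..<int m} UNIV"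
    using finite_same_card_bij[of "{0..<int m}" "UNIV :: 'n set"] assms by auto
  have "bij_betw (\<lambda>j. h (j mod int m)) {0..<int m} UNIV"
    using h by (rule bij_betw_cong[THEN iffD1, rotated]) auto
  then show ?thesis using that[of "\<lambda>j. h (j mod int m)"] by simp
qed

lemma periodic_factor:
  assumes s: "\<And>i. s (i + int m) = s i" "bij_betw s {0..<int m} UNIV" "0 < m"
    and z: "\<And>i. z (i + int m) = z i"
  obtains Z where "\<And>j. Z (s j) = z j"
proof
  fix j
  let ?Z = "\<lambda>i. z (inv_into {0..<int m} s i)"
  obtain j' where j': "(s j', z j') = (s j, z j)" "0 \<le> j'" "j' < 0 + int m"
    by (rule periodic_window[of "\<lambda>j. (s j, z j)" m j 0]) (use s z in auto)
  then have "inv_into {0..<int m} s (s j') = j'"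
    using s(2) by (intro inv_into_f_f) (auto simp: bij_betw_def)
  then show "?Z (s j) = z j" using j'(1) by simp
qed

text \<open>Summing \<open>u (j + 1) + u (j - 1) = 2 cos t *\<^sub>R u j\<close>, which has \<open>cos t < 1\<close>, over a period.\<close>

lemma regular_cycle_centred:
  assumes "3 \<le> m"
  shows "centred m (regular_cycle m)"
proof -
  define t where "t = 2 * pi / m"
  have t: "0 < t" "t < pi" using assms by (auto simp: t_def field_simps)
  have reg: "regular_cycle m j = unit_vec (of_int j * t)" for j
    by (simp add: regular_cycle_def t_def field_simps)
  define S where "S = (\<Sum>j\<in>{0..<int m}. regular_cycle m j)"
  have per: "regular_cycle m (j + int m) = regular_cycle m j" for j
    using assms by (intro regular_cycle_periodic) simp
  have "regular_cycle m (j + 1) + regular_cycle m (j + -1) = (2 * cos t) *\<^sub>R regular_cycle m j" for j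
    by (simp add: reg real2_eq_iff distrib_right left_diff_distrib cos_add cos_diff sin_add sin_diff)
  then have "(\<Sum>j\<in>{0..<int m}. regular_cycle m (j + 1)) + (\<Sum>j\<in>{0..<int m}. regular_cycle m (j + -1)) = (2 * cos t) *\<^sub>R S"
    by (simp add: S_def scaleR_sum_right flip: sum.distrib)
  then have "S + S = (2 * cos t) *\<^sub>R S"
    unfolding periodic_sum_shift[of "regular_cycle m" m, OF per] S_def .
  then have "(2 - 2 * cos t) *\<^sub>R S = 0" by (simp add: scaleR_left_diff_distrib scaleR_2)
  moreover have "cos t < 1" using cos_monotone_0_pi[of 0 t] t by simp
  ultimately show ?thesis by (simp add: centred_def S_def)
qed

text \<open>Cycles are parametrized by the Euclidean space \<open>(real^2)^'n\<close> to have compactness at hand. The set \<open>K\<close>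
  is cut out by weak inequalities with positive bounds, so it is closed and still consists of convex
  cycles.\<close>

theorem maximum_exists:
  assumes m: "3 \<le> m" and card: "CARD('n::finite) = m"
  shows "\<exists>u. convex_cycle m u \<and> centred m u \<and>
    (\<forall>w. convex_cycle m w \<longrightarrow> centred m w \<longrightarrow> cycle_functional m w \<le> cycle_functional m u)"
proof -
  have m0: "0 < m" using m by simp
  obtain s :: "int \<Rightarrow> 'n" where s: "\<And>i. s (i + int m) = s i" "bij_betw s {0..<int m} UNIV"
    using cyclic_enumeration[OF card m0] by blast
  define cyc where "cyc W j = W $ s j" for W :: "(real^2)^'n" and j
  define F0 where "F0 = cycle_functional m (regular_cycle m)"
  define \<epsilon> where "\<epsilon> = exp (F0 - m * ln (m + 1))"
  define \<delta> where "\<delta> = \<epsilon> / m\<^sup>2"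
  have \<delta>: "0 < \<delta>" "0 < \<epsilon> * \<delta>" using m0 by (simp_all add: \<delta>_def \<epsilon>_def)
  define K where "K = {W. centred m (cyc W)} \<inter> {W. isotropic m (cyc W)}
    \<inter> (\<Inter>i. {W. \<delta> \<le> det2 (cyc W (i - 1)) (cyc W i)})
    \<inter> (\<Inter>(i, k)\<in>{(i, k). i < k \<and> k < i + int m - 1}. {W. \<epsilon> * \<delta> \<le> triangle_det (cyc W (i - 1)) (cyc W i) (cyc W k)})"
  have K_cycle: "convex_cycle m (cyc W)" if "W \<in> K" for W
  proof
    show "0 < det2 (cyc W (i - 1)) (cyc W i)" for i
    proof -
      have "\<delta> \<le> det2 (cyc W (i - 1)) (cyc W i)" using that unfolding K_def by blast
      then show ?thesis using \<delta>(1) by simp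
    qed
    show "0 < triangle_det (cyc W (i - 1)) (cyc W i) (cyc W k)" if "i < k" "k < i + int m - 1" for i k
    proof -
      have "\<epsilon> * \<delta> \<le> triangle_det (cyc W (i - 1)) (cyc W i) (cyc W k)"
        using \<open>W \<in> K\<close> that unfolding K_def by blast
      then show ?thesis using \<delta>(2) by simp
    qed
  qed (use m s in \<open>auto simp: cyc_def\<close>)
  \<comment> \<open>Every admissible cycle that is at least as good as the regular one has an image in \<open>K\<close>.\<close>
  have captured: "\<exists>W\<in>K. cycle_functional m w = cycle_functional m (cyc W)"
    if "convex_cycle m w" "centred m w" "F0 \<le> cycle_functional m w" for w
  proof -
    interpret w: convex_cycle m w by fact
    obtain A :: "real^2^2" where A: "0 < det A" "isotropic m (\<lambda>i. A *v w i)"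
      using w.exists_isotropic_image by blast
    define u where "u = (\<lambda>i. A *v w i)"
    interpret u: convex_cycle m u unfolding u_def by (rule w.linear_image_cycle[OF A(1)])
    have F: "cycle_functional m u = cycle_functional m w"
      unfolding u_def by (rule w.linear_image_functional[OF A(1)])
    have iso: "isotropic m u" "centred m u"
      using A(2) centred_matrix_image[OF that(2), of A] by (simp_all add: u_def)
    obtain Z where Z: "\<And>j. Z (s j) = u j"
      using periodic_factor[of s m u, OF s m0 u.periodic] by blast
    define W where "W = (\<chi> i. Z i)"
    have cycW: "cyc W = u" by (auto simp: cyc_def W_def Z)
    note bounds = u.lower_bounds[OF iso, of F0, folded \<epsilon>_def, folded \<delta>_def]
    have "W \<in> K"
      using bounds u.triangle_ge_corner[of "\<epsilon> * \<delta>"] that(3) F iso by (auto simp: K_def cycW)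
    moreover have "cycle_functional m w = cycle_functional m (cyc W)" using F cycW by simp
    ultimately show ?thesis by blast
  qed
  have cont: "continuous_on S (\<lambda>W. cyc W j $ n)" for S j n
    unfolding cyc_def by (intro continuous_intros)
  have cont_inner: "continuous_on S (\<lambda>W. n \<bullet> cyc W j)" for S j n
    unfolding cyc_def by (intro continuous_intros)
  have cont_det: "continuous_on S (\<lambda>W. det2 (cyc W i) (cyc W j))" for S i j
    unfolding det2_def by (intro continuous_intros cont)
  have cont_tri: "continuous_on S (\<lambda>W. triangle_det (cyc W i) (cyc W j) (cyc W k))" for S i j k
    unfolding triangle_det_def by (intro continuous_intros cont_det)
  have "closed {W. centred m (cyc W)}"
    unfolding centred_def cyc_def by (intro closed_Collect_eq continuous_intros)
  moreover have "closed {W. isotropic m (cyc W)}"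
    unfolding isotropic_def by (intro closed_Collect_all closed_Collect_eq continuous_intros cont_inner)
  ultimately have "closed K"
    unfolding K_def by (intro closed_Int closed_INT ballI) (auto intro!: closed_Collect_le continuous_intros cont_det cont_tri)
  moreover have "bounded K"
  proof (rule boundedI)
    fix W assume W: "W \<in> K"
    interpret W: convex_cycle m "cyc W" by (rule K_cycle[OF W])
    have "isotropic m (cyc W)" using W by (simp add: K_def)
    then have le: "norm (cyc W j) \<le> 1" for j by (rule W.isotropic_norm_le)
    have "norm (W $ i) \<le> 1" for i
    proof -
      obtain j where "i = s j" using s(2) by (auto simp: bij_betw_def)
      then show ?thesis using le[of j] by (simp add: cyc_def)
    qed
    then have "(\<Sum>i\<in>UNIV. norm (W $ i)) \<le> (\<Sum>i\<in>(UNIV :: 'n set). 1)" by (intro sum_mono)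
    moreover have "norm W \<le> (\<Sum>i\<in>UNIV. norm (W $ i))" unfolding norm_vec_def by (rule L2_set_le_sum) simp
    ultimately show "norm W \<le> real CARD('n)" by simp
  qed
  ultimately have "compact K" by (simp add: compact_eq_bounded_closed)
  moreover have "K \<noteq> {}"
    using captured[of "regular_cycle m"] regular_convex_cycle[OF m] regular_cycle_centred[OF m]
    by (auto simp: F0_def)
  moreover have "continuous_on K (\<lambda>W. cycle_functional m (cyc W))"
    unfolding cycle_functional_def
  proof (intro continuous_on_sum continuous_on_diff continuous_on_ln cont_det cont_tri ballI)
    fix W j assume "W \<in> K"
    interpret W: convex_cycle m "cyc W" by (rule K_cycle) fact
    show "triangle_det (cyc W (j - 1)) (cyc W j) (cyc W (j + 1)) \<noteq> 0"
      "det2 (cyc W (j - 1)) (cyc W j) \<noteq> 0"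
      using W.corner_pos[of j] W.det_pos[of j] by auto
  qed
  ultimately obtain V where V: "V \<in> K"
    "\<And>W. W \<in> K \<Longrightarrow> cycle_functional m (cyc W) \<le> cycle_functional m (cyc V)"
    using continuous_attains_sup[of K "\<lambda>W. cycle_functional m (cyc W)"] by blast
  have "F0 \<le> cycle_functional m (cyc V)"
    using captured[of "regular_cycle m"] regular_convex_cycle[OF m] regular_cycle_centred[OF m] V(2)
    by (force simp: F0_def)
  then have "cycle_functional m w \<le> cycle_functional m (cyc V)"
    if "convex_cycle m w" "centred m w" for w
    using captured[OF that] V(2) by (cases "F0 \<le> cycle_functional m w") auto
  then show ?thesis using K_cycle[OF V(1)] V(1) by (auto simp: K_def)
qed

text \<open>Convexity is an open condition, so small centred variations of \<open>u\<close> compete with \<open>u\<close>.\<close>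

lemma maximum_imp_regular:
  assumes u: "convex_cycle m u" "centred m u"
    and max: "\<And>w. convex_cycle m w \<Longrightarrow> centred m w \<Longrightarrow> cycle_functional m w \<le> cycle_functional m u"
  shows "\<exists>A :: real^2^2. 0 < det A \<and> u = (\<lambda>i. A *v regular_cycle m i)"
proof -
  interpret convex_cycle m u by fact
  have "first_variation m u z = 0"
    if z: "\<And>i. z (i + int m) = z i" and sum: "(\<Sum>j\<in>{0..<int m}. z j) = 0" for z
  proof -
    have "centred m (\<lambda>j. u j + t *\<^sub>R z j)" for t
      using u(2) sum by (simp add: centred_def sum.distrib flip: scaleR_sum_right)
    then have "\<forall>\<^sub>F t in nhds 0. cycle_functional m (\<lambda>j. u j + t *\<^sub>R z j) \<le> cycle_functional m u"
      using eventually_convex_cycle[of z, OF z] by (auto elim!: eventually_mono intro: max)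
    then obtain \<epsilon> where \<epsilon>: "0 < \<epsilon>"
      "\<And>t. dist t 0 < \<epsilon> \<Longrightarrow> cycle_functional m (\<lambda>j. u j + t *\<^sub>R z j) \<le> cycle_functional m u"
      unfolding eventually_nhds_metric by blast
    show ?thesis
      by (rule DERIV_local_max[OF functional_has_derivative \<epsilon>(1)]) (use \<epsilon>(2) in \<open>auto simp: dist_real_def\<close>)
  qed
  then show ?thesis
    using u(2) by (intro regular_if_covector_zero covector_zero_if_constrained_critical) (auto simp: centred_def)
qed

theorem regular_maximum:
  assumes m: "3 \<le> m" and card: "CARD('n::finite) = m" and w: "convex_cycle m w" "centred m w"
  shows "cycle_functional m w \<le> cycle_functional m (regular_cycle m)"
    and "cycle_functional m (regular_cycle m) \<le> cycle_functional m w \<Longrightarrow>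
      \<exists>A :: real^2^2. 0 < det A \<and> w = (\<lambda>i. A *v regular_cycle m i)"
proof -
  obtain u where u: "convex_cycle m u" "centred m u"
    and max: "\<And>w. convex_cycle m w \<Longrightarrow> centred m w \<Longrightarrow> cycle_functional m w \<le> cycle_functional m u"
    using maximum_exists[OF m card] by blast
  obtain A :: "real^2^2" where A: "0 < det A" "u = (\<lambda>i. A *v regular_cycle m i)"
    using maximum_imp_regular[OF u max] by blast
  have F: "cycle_functional m u = cycle_functional m (regular_cycle m)"
    unfolding A(2) by (rule convex_cycle.linear_image_functional[OF regular_convex_cycle[OF m] A(1)])
  show "cycle_functional m w \<le> cycle_functional m (regular_cycle m)" using max[OF w] F by simp
  assume "cycle_functional m (regular_cycle m) \<le> cycle_functional m w"
  then show "\<exists>A :: real^2^2. 0 < det A \<and> w = (\<lambda>i. A *v regular_cycle m i)"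
    using max F by (intro maximum_imp_regular[OF w]) force
qed

section \<open>Stationary polygons and maximizers\<close>

text \<open>A linear map that reverses the orientation may be composed with a reflection that preserves the
  regular polygon.\<close>

lemma linear_image_of_regular_iff:
  assumes "0 < m"
  shows "linear_image_of P (regular_polygon m) \<longleftrightarrow>
    (\<exists>A :: real^2^2. 0 < det A \<and> P = convex hull (range (\<lambda>i. A *v regular_cycle m i)))"
    (is "?L \<longleftrightarrow> ?R")
proof
  assume ?L
  then obtain A :: "real^2^2" where A: "det A \<noteq> 0" "P = convex hull (range (\<lambda>i. A *v regular_cycle m i))"
    unfolding linear_image_of_def regular_polygon_eq[OF assms] convex_hull_matrix_image[symmetric]
    by (auto simp: invertible_det_nz)
  show ?R
  proof (cases "0 < det A")
    case False
    define R :: "real^2^2" where "R = vector [vector [1, 0], vector [0, -1]]"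
    have R: "R *v regular_cycle m i = regular_cycle m (- i)" for i
      by (simp add: R_def regular_cycle_def real2_eq_iff matrix_vector_mult_def sum_2)
    have "range uminus = (UNIV :: int set)" by (metis minus_minus surjI)
    then have "range (\<lambda>i. A *v regular_cycle m i) = (\<lambda>i. A *v regular_cycle m i) ` range uminus" by simp
    also have "\<dots> = range (\<lambda>i. A *v regular_cycle m (- i))" by (simp only: image_image)
    also have "\<dots> = range (\<lambda>i. (A ** R) *v regular_cycle m i)"
      by (simp add: R flip: matrix_vector_mul_assoc)
    finally have "P = convex hull (range (\<lambda>i. (A ** R) *v regular_cycle m i))" using A(2) by simp
    moreover have "det R = - 1" by (simp add: R_def det_2)
    then have "0 < det (A ** R)" using A(1) False by (simp add: det_mul)
    ultimately show ?thesis by blast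
  qed (use A in blast)
next
  assume ?R
  then show ?L
    unfolding linear_image_of_def regular_polygon_eq[OF assms] convex_hull_matrix_image
    by (metis invertible_det_nz less_irrefl)
qed

text \<open>The dual vertices of a regular cycle are, up to a quarter turn, differences of consecutive
  vertices, with one common factor; so their sum telescopes.\<close>

lemma regular_image_dual_centred:
  assumes "3 \<le> m"
  shows "centred m (dual_vertex (\<lambda>i. A *v regular_cycle m i))"
proof -
  define v where "v = (\<lambda>i. A *v regular_cycle m i)"
  define d where "d = det A * sin (2 * pi / m)"
  have "det2 (v (i - 1)) (v i) = d" for i
    by (simp add: v_def d_def det2_matrix regular_cycle_def det2_unit_vec diff_divide_distrib right_diff_distrib)
  then have dual: "dual_vertex v i = (quarter_turn (v (i + -1)) - quarter_turn (v i)) /\<^sub>R d" for i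
    by (simp add: dual_vertex_def real2_eq_iff)
  have "v (i + int m) = v i" for i
    using regular_cycle_periodic[of m i] assms by (simp add: v_def)
  then have "(\<Sum>i\<in>{0..<int m}. quarter_turn (v (i + -1))) = (\<Sum>i\<in>{0..<int m}. quarter_turn (v i))"
    by (intro periodic_sum_shift) simp
  then show ?thesis
    by (simp only: centred_def v_def[symmetric] dual flip: scaleR_sum_right) (simp add: sum_subtractf)
qed

text \<open>Regularity passes to the dual cycle: it means that both the determinants of edges and those of
  corners are constant.\<close>

lemma (in convex_cycle) regular_if_dual_regular:
  assumes "e = (\<lambda>i. A *v regular_cycle m i)"
  shows "\<exists>B :: real^2^2. 0 < det B \<and> v = (\<lambda>i. B *v regular_cycle m i)"
proof -
  interpret dual: convex_cycle m e by (rule dual_convex_cycle)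
  define t where "t = 2 * pi / m"
  have reg: "regular_cycle m i = unit_vec (of_int i * t)" for i
    by (simp add: regular_cycle_def t_def mult.commute)
  define D where "D = det A * sin t"
  define T where "T = det A * (4 * sin (t / 2) * sin (t / 2) * sin t)"
  have D: "det2 (e (i - 1)) (e i) = D" for i
    by (simp add: assms det2_matrix reg det2_unit_vec D_def left_diff_distrib)
  have D': "det2 (e i) (e (i + 1)) = D" for i using D[of "i + 1"] by simp
  have T: "triangle_det (e (i - 1)) (e i) (e (i + 1)) = T" for i
    by (simp add: assms triangle_det_matrix reg triangle_det_unit_vec T_def left_diff_distrib distrib_right)
  have D_pos: "0 < D" using dual.det_pos[of 0] D[of 0] by simp
  define d where "d = T / (D * D)"
  have dv: "det2 (v (i - 1)) (v i) = d" for i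
    using dual.dual_det[of i] D_pos unfolding dual_dual D D' T
    by (simp add: d_def field_simps)
  have tri: "triangle_det (v (i - 1)) (v i) (v (i + 1)) = D * d * d" for i
    using dual_det[of i] dv[of i] dv[of "i + 1"] D' by simp
  show ?thesis
  proof (rule regular_if_constant)
    show "det2 (v (i - 1)) (v i) = d" for i by (rule dv)
    show "det2 (v (i - 1)) (v (i + 1)) = 2 * d - D * d * d" for i
      using tri[of i] dv[of i] dv[of "i + 1"] det2_swap[of "v (i - 1)" "v (i + 1)"]
      by (simp add: triangle_det_def)
  qed
qed

text \<open>Near \<open>V\<close>, along every line, the chart lists the vertices of a convex cycle, whose \<open>c1\<close> is
  the cycle functional. So the differential restricts to the first variation.\<close>

lemma stationary_imp_regular:
  assumes m: "3 \<le> m" and P: "P \<in> polygons m" and stat: "c1_stationary TYPE('n::finite) P"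
  shows "linear_image_of P (regular_polygon m)"
proof -
  obtain v where v: "convex_cycle m v" and P_eq: "P = convex hull (range v)"
    using polygons_obtain_cycle[OF P m] by blast
  interpret convex_cycle m v by fact
  obtain V :: "(real^2)^'n" where bij: "bij_betw (\<lambda>i. V $ i) UNIV (range v)"
    and deriv: "((\<lambda>W :: (real^2)^'n. c1 (convex hull (range (\<lambda>i. W $ i)))) has_derivative (\<lambda>_. 0)) (at V)"
    using stat extreme_points unfolding c1_stationary_def P_eq by auto
  define s where "s j = inv_into UNIV (\<lambda>i. V $ i) (v j)" for j
  have s: "V $ s j = v j" for j
    unfolding s_def using bij by (intro f_inv_into_f) (auto simp: bij_betw_def)
  have s_per: "s (j + int m) = s j" for j by (simp add: s_def)
  have "\<exists>j. i = s j" for i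
  proof -
    have "V $ i \<in> range v" using bij by (auto simp: bij_betw_def)
    then obtain j where "V $ i = V $ s j" using s by auto
    then have "i = s j" using bij by (auto simp: bij_betw_def inj_def)
    then show ?thesis ..
  qed
  then have s_range: "range s = UNIV" by auto
  have s_bij: "bij_betw s {0..<int m} UNIV"
  proof (rule bij_betw_imageI)
    show "inj_on s {0..<int m}"
    proof (rule inj_onI)
      fix i j assume "i \<in> {0..<int m}" "j \<in> {0..<int m}" "s i = s j"
      then show "i = j" using s[of i] s[of j] inj_on_window[of 0] by (auto dest: inj_onD)
    qed
    show "s ` {0..<int m} = UNIV"
      using periodic_range[of s m, OF s_per m_pos] s_range by simp
  qed
  have "first_variation m v z = 0" if z: "\<And>i. z (i + int m) = z i" for z
  proof -
    obtain Z0 where Z0: "\<And>j. Z0 (s j) = z j"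
      using periodic_factor[of s m z, OF s_per s_bij m_pos z] by blast
    define Z :: "(real^2)^'n" where "Z = (\<chi> i. Z0 i)"
    define G where "G t = c1 (convex hull (range (\<lambda>i. (V + t *\<^sub>R Z) $ i)))" for t
    have hull: "range (\<lambda>i. (V + t *\<^sub>R Z) $ i) = range (\<lambda>j. v j + t *\<^sub>R z j)" for t
    proof -
      have "range (\<lambda>i. (V + t *\<^sub>R Z) $ i) = (\<lambda>i. (V + t *\<^sub>R Z) $ i) ` range s" unfolding s_range ..
      also have "\<dots> = range (\<lambda>j. v j + t *\<^sub>R z j)" by (simp add: image_image s Z_def Z0)
      finally show ?thesis .
    qed
    have "((\<lambda>t. V + t *\<^sub>R Z) has_derivative (\<lambda>t. t *\<^sub>R Z)) (at 0)"
      by (auto intro!: derivative_eq_intros)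
    moreover have "((\<lambda>W :: (real^2)^'n. c1 (convex hull (range (\<lambda>i. W $ i)))) has_derivative (\<lambda>_. 0)) (at (V + 0 *\<^sub>R Z))"
      using deriv by simp
    ultimately have "(G has_derivative (\<lambda>_. 0)) (at 0)"
      unfolding G_def by (rule has_derivative_compose)
    then have "(G has_real_derivative 0) (at 0)"
      by (simp add: has_field_derivative_def lambda_zero)
    moreover have "\<forall>\<^sub>F t in nhds 0. G t = cycle_functional m (\<lambda>j. v j + t *\<^sub>R z j)"
      using eventually_convex_cycle[of z, OF z]
      by eventually_elim (unfold G_def hull, rule convex_cycle.c1_eq)
    ultimately have "((\<lambda>t. cycle_functional m (\<lambda>j. v j + t *\<^sub>R z j)) has_real_derivative 0) (at 0)"
      by (subst (asm) DERIV_cong_ev[OF refl _ refl])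
    then show ?thesis using functional_has_derivative by (rule DERIV_unique[symmetric])
  qed
  then obtain A :: "real^2^2" where "0 < det A" "v = (\<lambda>i. A *v regular_cycle m i)"
    using regular_if_covector_zero[OF covector_zero_if_critical] by blast
  then show ?thesis unfolding linear_image_of_regular_iff[OF m_pos] P_eq by blast
qed

theorem theorem1p8:
  fixes m :: nat
  assumes "m \<ge> 3" and "CARD('n::finite) = m"
  shows "(\<forall>P \<in> polygons m. c1_stationary TYPE('n) P \<longrightarrow> linear_image_of P (regular_polygon m)) \<and>
         (\<forall>P. is_arg_max c1 (\<lambda>Q. Q \<in> polygons m \<and> s_inf Q = 0) P \<longleftrightarrow>
              linear_image_of P (regular_polygon m))"
proof -
  have m: "3 \<le> m" "0 < m" using assms(1) by simp_all
  note max = regular_maximum[OF m(1) assms(2)]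
  have regular: "P \<in> polygons m \<and> s_inf P = 0 \<and> c1 P = cycle_functional m (regular_cycle m)"
    if lin: "linear_image_of P (regular_polygon m)" for P
  proof -
    obtain A :: "real^2^2" where A: "0 < det A" "P = convex hull (range (\<lambda>i. A *v regular_cycle m i))"
      using lin unfolding linear_image_of_regular_iff[OF m(2)] by blast
    interpret reg: convex_cycle m "regular_cycle m" by (rule regular_convex_cycle[OF m(1)])
    interpret v: convex_cycle m "\<lambda>i. A *v regular_cycle m i" by (rule reg.linear_image_cycle[OF A(1)])
    show ?thesis
      using v.polygon_mem v.s_inf_eq_0_iff v.c1_eq reg.linear_image_functional[OF A(1)]
        regular_image_dual_centred[OF m(1), of A] by (simp add: A(2) centred_def)
  qed
  have bound: "c1 Q \<le> cycle_functional m (regular_cycle m) \<and>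
      (cycle_functional m (regular_cycle m) \<le> c1 Q \<longrightarrow> linear_image_of Q (regular_polygon m))"
    if Q: "Q \<in> polygons m" "s_inf Q = 0" for Q
  proof -
    obtain v where v: "convex_cycle m v" and Q_eq: "Q = convex hull (range v)"
      using polygons_obtain_cycle[OF Q(1) m(1)] by blast
    interpret convex_cycle m v by fact
    have c1: "c1 Q = cycle_functional m e" unfolding Q_eq c1_eq dual_functional ..
    have centred: "centred m e" using Q(2) s_inf_eq_0_iff by (simp add: Q_eq centred_def)
    note max' = max[OF dual_convex_cycle centred]
    have "linear_image_of Q (regular_polygon m)"
      if le: "cycle_functional m (regular_cycle m) \<le> cycle_functional m e"
    proof -
      obtain A :: "real^2^2" where "e = (\<lambda>i. A *v regular_cycle m i)" using max'(2)[OF le] by blast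
      then show ?thesis
        unfolding linear_image_of_regular_iff[OF m(2)] Q_eq using regular_if_dual_regular by metis
    qed
    then show ?thesis using max'(1) c1 by simp
  qed
  have "linear_image_of (regular_polygon m) (regular_polygon m)"
    unfolding linear_image_of_def by (intro exI[of _ "mat 1"]) (simp add: invertible_det_nz)
  note base = regular[OF this]
  have "is_arg_max c1 (\<lambda>Q. Q \<in> polygons m \<and> s_inf Q = 0) P \<longleftrightarrow> linear_image_of P (regular_polygon m)" for P
  proof
    assume "is_arg_max c1 (\<lambda>Q. Q \<in> polygons m \<and> s_inf Q = 0) P"
    then have "P \<in> polygons m" "s_inf P = 0" "c1 (regular_polygon m) \<le> c1 P"
      using base by (auto simp: is_arg_max_def not_less)
    then show "linear_image_of P (regular_polygon m)" using bound base by simp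
  next
    assume "linear_image_of P (regular_polygon m)"
    from regular[OF this] show "is_arg_max c1 (\<lambda>Q. Q \<in> polygons m \<and> s_inf Q = 0) P"
      using bound by (auto simp: is_arg_max_def not_less)
  qed
  then show ?thesis using stationary_imp_regular[OF m(1)] by blast
qed

end
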